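(* Let $w_2>w_1$ and $R=\{(u,w):\ u_1\le u\le u_2,\ w_1\le w\le w_2\}$, and assume $a(u,w)>0$ and $b(u,w)>0$ in $R$. Then to every solution $U(w)$ of class $C^1([w_1,w_2])$ of the problem $$U'(w)=\gamma\,\frac{b(U(w),w)}{a(U(w),w)},\qquad U(w_1)=u_1,\quad U(w_2)=u_2$$ (where $\gamma$ is a real number) there corresponds a functional solution of the problem $$\nabla\cdot(a(u,w)\nabla u)=0\ \text{in }\Omega,\quad u=u_1\ \text{on }\Gamma_1,\quad u=u_2\ \text{on }\Gamma_2,\quad \frac{\partial u}{\partial n}=0\ \text{on }\Gamma_3,$$ $$\nabla\cdot(b(u,w)\nabla w)=0\ \text{in }\Omega,\quad w=w_1\ \text{on }\Gamma_1,\quad w=w_2\ \text{on }\Gamma_2,\quad \frac{\partial w}{\partial n}=0\ \text{on }\Gamma_3.$$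
   Context: $\Omega$ is an open and bounded subset of $\mathbf{R}^N$ with boundary $\Gamma$ divided into three parts $\Gamma_1,\Gamma_2,\Gamma_3$, and $\partial/\partial n$ is the normal derivative; $u_1,u_2,w_1,w_2$ are constants. The boundary of $\Omega$ is assumed to have a degree of regularity which makes solvable the mixed problem $\Delta z=0$ in $\Omega$, $z=0$ on $\Gamma_1$, $z=1$ on $\Gamma_2$, $\frac{\partial z}{\partial n}=0$ on $\Gamma_3$. A classical solution $(u(\mathbf{x}),w(\mathbf{x}))$ of the system is called functional if a function $U(t)\in C^1([w_1,w_2])$ exists such that $u(\mathbf{x})=U(w(\mathbf{x}))$.
   Formalization: The coefficients a and b are assumed continuous on R (for discontinuous b a classical solution can fail to exist), u₁ ≤ u₂ so that R is nonempty, and the boundary is taken to be C¹ at points of Γ₃ so that the normal derivative makes sense. *)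

theory Defs
  imports "HOL-Analysis.Analysis"
begin

text \<open>Derivatives are taken within \<open>S\<close>: for open \<open>S\<close> this is the usual notion,
  for \<open>S = {p..q}\<close> it is one-sided at the end points.\<close>

definition C1_on :: "('a::real_normed_vector \<Rightarrow> 'b::real_normed_vector) \<Rightarrow> 'a set \<Rightarrow> bool" where
  "C1_on f S \<longleftrightarrow>
     (\<exists>f'. (\<forall>x\<in>S. (f has_derivative blinfun_apply (f' x)) (at x within S)) \<and> continuous_on S f')"

definition grad :: "('a::euclidean_space \<Rightarrow> real) \<Rightarrow> 'a \<Rightarrow> 'a" where
  "grad f x = (\<Sum>i\<in>Basis. frechet_derivative f (at x) i *\<^sub>R i)"

definition divergence :: "('a::euclidean_space \<Rightarrow> 'a) \<Rightarrow> 'a \<Rightarrow> real" where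
  "divergence F x = (\<Sum>i\<in>Basis. frechet_derivative F (at x) i \<bullet> i)"

definition laplacian :: "('a::euclidean_space \<Rightarrow> real) \<Rightarrow> 'a \<Rightarrow> real" where
  "laplacian f = divergence (grad f)"

lemma grad_eq_GDERIV:
  assumes "GDERIV f x :> D"
  shows "grad f x = D"
proof -
  have "frechet_derivative f (at x) = (\<lambda>h. h \<bullet> D)"
    using assms unfolding gderiv_def by (metis frechet_derivative_at)
  then show ?thesis
    by (simp add: grad_def inner_commute[of _ D] euclidean_representation)
qed

text \<open>Near \<open>x\<close> the boundary is a \<open>C\<^sup>1\<close> hypersurface with \<open>\<Omega>\<close> on one side,
  described by the local defining function \<open>\<phi>\<close>; the unit vector \<open>\<nu>\<close> does not depend
  on the choice of \<open>\<phi>\<close>.\<close>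

definition outward_unit_normal :: "'a::euclidean_space set \<Rightarrow> 'a \<Rightarrow> 'a \<Rightarrow> bool" where
  "outward_unit_normal \<Omega> x \<nu> \<longleftrightarrow>
     x \<in> frontier \<Omega> \<and>
     (\<exists>V \<phi>. open V \<and> x \<in> V \<and> C1_on \<phi> V \<and> grad \<phi> x \<noteq> 0 \<and>
            \<Omega> \<inter> V = {y \<in> V. \<phi> y < 0} \<and> \<nu> = grad \<phi> x /\<^sub>R norm (grad \<phi> x))"

text \<open>The difference quotient is one-sided, along the inner normal, because functions are
  only considered on \<open>closure \<Omega>\<close>.\<close>

definition has_normal_derivative ::
    "('a::euclidean_space \<Rightarrow> real) \<Rightarrow> 'a \<Rightarrow> 'a \<Rightarrow> real \<Rightarrow> bool" where
  "has_normal_derivative v \<nu> x d \<longleftrightarrow>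
     ((\<lambda>t. (v x - v (x - t *\<^sub>R \<nu>)) / t) \<longlongrightarrow> d) (at_right 0)"

definition mixed_bc ::
    "'a::euclidean_space set \<Rightarrow> 'a set \<Rightarrow> 'a set \<Rightarrow> ('a \<Rightarrow> 'a) \<Rightarrow> real \<Rightarrow> real \<Rightarrow> ('a \<Rightarrow> real) \<Rightarrow> bool" where
  "mixed_bc \<Gamma>\<^sub>1 \<Gamma>\<^sub>2 \<Gamma>\<^sub>3 n p q v \<longleftrightarrow>
     (\<forall>x\<in>\<Gamma>\<^sub>1. v x = p) \<and> (\<forall>x\<in>\<Gamma>\<^sub>2. v x = q) \<and>
     (\<forall>x\<in>\<Gamma>\<^sub>3. has_normal_derivative v (n x) x 0)"

definition mixed_laplace_solution ::
    "'a::euclidean_space set \<Rightarrow> 'a set \<Rightarrow> 'a set \<Rightarrow> 'a set \<Rightarrow> ('a \<Rightarrow> 'a) \<Rightarrow> ('a \<Rightarrow> real) \<Rightarrow> bool" where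
  "mixed_laplace_solution \<Omega> \<Gamma>\<^sub>1 \<Gamma>\<^sub>2 \<Gamma>\<^sub>3 n z \<longleftrightarrow>
     continuous_on (closure \<Omega>) z \<and> C1_on z \<Omega> \<and> C1_on (grad z) \<Omega> \<and>
     (\<forall>x\<in>\<Omega>. laplacian z x = 0) \<and>
     mixed_bc \<Gamma>\<^sub>1 \<Gamma>\<^sub>2 \<Gamma>\<^sub>3 n 0 1 z"

text \<open>Classical solutions: the equations hold pointwise, with \<open>u\<close>, \<open>w\<close> and the fluxes
  \<open>a(u,w)\<nabla>u\<close>, \<open>b(u,w)\<nabla>w\<close> of class \<open>C\<^sup>1\<close> in \<open>\<Omega>\<close>. The coefficients
  are not required to be differentiable; where they are positive and of class \<open>C\<^sup>1\<close>, the flux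
  condition is equivalent to \<open>u\<close> and \<open>w\<close> being of class \<open>C\<^sup>2\<close> in \<open>\<Omega>\<close>.\<close>

definition classical_solution ::
    "(real \<Rightarrow> real \<Rightarrow> real) \<Rightarrow> (real \<Rightarrow> real \<Rightarrow> real) \<Rightarrow>
     'a::euclidean_space set \<Rightarrow> 'a set \<Rightarrow> 'a set \<Rightarrow> 'a set \<Rightarrow> ('a \<Rightarrow> 'a) \<Rightarrow>
     real \<Rightarrow> real \<Rightarrow> real \<Rightarrow> real \<Rightarrow> ('a \<Rightarrow> real) \<Rightarrow> ('a \<Rightarrow> real) \<Rightarrow> bool" where
  "classical_solution a b \<Omega> \<Gamma>\<^sub>1 \<Gamma>\<^sub>2 \<Gamma>\<^sub>3 n u\<^sub>1 u\<^sub>2 w\<^sub>1 w\<^sub>2 u w \<longleftrightarrow>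
     continuous_on (closure \<Omega>) u \<and> continuous_on (closure \<Omega>) w \<and>
     C1_on u \<Omega> \<and> C1_on w \<Omega> \<and>
     C1_on (\<lambda>x. a (u x) (w x) *\<^sub>R grad u x) \<Omega> \<and>
     C1_on (\<lambda>x. b (u x) (w x) *\<^sub>R grad w x) \<Omega> \<and>
     (\<forall>x\<in>\<Omega>. divergence (\<lambda>y. a (u y) (w y) *\<^sub>R grad u y) x = 0) \<and>
     (\<forall>x\<in>\<Omega>. divergence (\<lambda>y. b (u y) (w y) *\<^sub>R grad w y) x = 0) \<and>
     mixed_bc \<Gamma>\<^sub>1 \<Gamma>\<^sub>2 \<Gamma>\<^sub>3 n u\<^sub>1 u\<^sub>2 u \<and>
     mixed_bc \<Gamma>\<^sub>1 \<Gamma>\<^sub>2 \<Gamma>\<^sub>3 n w\<^sub>1 w\<^sub>2 w"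

text \<open>\<open>functional_by U w\<^sub>1 w\<^sub>2 \<Omega> u w\<close>: the pair \<open>(u, w)\<close> is functional, with
  \<open>U\<close> as the witnessing function. Since \<open>U\<close> lives on \<open>[w\<^sub>1, w\<^sub>2]\<close> only,
  \<open>u = U \<circ> w\<close> includes that \<open>w\<close> takes its values there.\<close>

definition functional_by ::
    "(real \<Rightarrow> real) \<Rightarrow> real \<Rightarrow> real \<Rightarrow> 'a::euclidean_space set \<Rightarrow> ('a \<Rightarrow> real) \<Rightarrow> ('a \<Rightarrow> real) \<Rightarrow> bool" where
  "functional_by U w\<^sub>1 w\<^sub>2 \<Omega> u w \<longleftrightarrow>
     C1_on U {w\<^sub>1..w\<^sub>2} \<and> (\<forall>x\<in>closure \<Omega>. w x \<in> {w\<^sub>1..w\<^sub>2} \<and> u x = U (w x))"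

end

theory Submission
  imports Defs
begin

text \<open>Let \<open>K = \<integral> b(U(t),t) dt\<close> over \<open>[w\<^sub>1, w\<^sub>2]\<close> and let \<open>\<Psi> : [0,1] \<rightarrow> [w\<^sub>1, w\<^sub>2]\<close> be the inverse of the
  normalized antiderivative of \<open>t \<mapsto> b(U(t),t)\<close>, so that \<open>\<Psi>' = K / b(U(\<Psi>),\<Psi>)\<close>. For a solution \<open>z\<close> of
  the mixed Laplace problem put \<open>w = \<Psi>(z)\<close> and \<open>u = U(w)\<close>. Then \<open>b(u,w)\<nabla>w = K \<nabla>z\<close> and
  \<open>a(u,w)\<nabla>u = \<gamma> K \<nabla>z\<close>, and both fluxes are divergence free.

  This requires \<open>0 \<le> z \<le> 1\<close>, which need not hold on components of \<open>\<Omega>\<close> whose whole boundary lies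
  in \<open>\<Gamma>\<^sub>3\<close>. On each component the maximum principle shows that \<open>z\<close> either satisfies the bounds
  or is constant, so truncating \<open>z\<close> to \<open>[0,1]\<close> gives another solution. Because \<open>\<Gamma>\<^sub>3\<close> is only
  \<open>C\<^sup>1\<close>, Hopf's lemma is not available; a quadratic barrier does the job, since the
  normal derivative vanishes on a whole neighbourhood of a maximum point in the boundary.\<close>

section \<open>Gradients and harmonic functions\<close>

text \<open>\<open>frechet_derivative\<close> is a choice among all derivatives at the point, so it
  suffices that both functions admit the same derivatives there. This covers points without
  differentiability as well.\<close>

lemma frechet_derivative_cong_open:
  assumes "open S" "x \<in> S" "\<And>y. y \<in> S \<Longrightarrow> f y = g y"
  shows "frechet_derivative f (at x) = frechet_derivative g (at x)"
proof -
  have "(f has_derivative D) (at x) \<longleftrightarrow> (g has_derivative D) (at x)" for D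
    using has_derivative_transform_within_open[OF _ assms(1,2)] assms(3) by metis
  then show ?thesis by (simp add: frechet_derivative_def)
qed

lemma grad_cong_open:
  assumes "open S" "x \<in> S" "\<And>y. y \<in> S \<Longrightarrow> f y = g y"
  shows "grad f x = grad g x"
  using frechet_derivative_cong_open[OF assms] by (simp add: grad_def)

lemma divergence_cong_open:
  assumes "open S" "x \<in> S" "\<And>y. y \<in> S \<Longrightarrow> F y = G y"
  shows "divergence F x = divergence G x"
  using frechet_derivative_cong_open[OF assms] by (simp add: divergence_def)

section \<open>Calculus of the class C1 and its local character\<close>

lemma C1_onI:
  assumes "\<And>x. x \<in> S \<Longrightarrow> (f has_derivative blinfun_apply (f' x)) (at x within S)"
    and "continuous_on S f'"
  shows "C1_on f S"
  unfolding C1_on_def using assms by (intro exI[of _ f']) simp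

lemma C1_onE:
  assumes "C1_on f S"
  obtains f' where "\<forall>x\<in>S. (f has_derivative blinfun_apply (f' x)) (at x within S)"
    and "continuous_on S f'"
proof -
  from assms obtain f' where "(\<forall>x\<in>S. (f has_derivative blinfun_apply (f' x)) (at x within S)) \<and> continuous_on S f'"
    unfolding C1_on_def ..
  then show thesis by (intro that) auto
qed

lemma C1_on_cong:
  assumes "C1_on f S" "\<And>y. y \<in> S \<Longrightarrow> f y = g y"
  shows "C1_on g S"
proof -
  obtain f' where f': "\<forall>x\<in>S. (f has_derivative blinfun_apply (f' x)) (at x within S)"
    "continuous_on S f'"
    using assms(1) by (rule C1_onE)
  have "(g has_derivative blinfun_apply (f' x)) (at x within S)" if "x \<in> S" for x
    using has_derivative_transform[OF that _ f'(1)[rule_format, OF that], of g] assms(2) by simp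
  then show ?thesis using f'(2) by (rule C1_onI)
qed

lemma C1_on_subset:
  assumes "C1_on f S" "T \<subseteq> S"
  shows "C1_on f T"
proof -
  obtain f' where f': "\<forall>x\<in>S. (f has_derivative blinfun_apply (f' x)) (at x within S)"
    "continuous_on S f'"
    using assms(1) by (rule C1_onE)
  have "(f has_derivative blinfun_apply (f' x)) (at x within T)" if "x \<in> T" for x
    using has_derivative_subset[OF f'(1)[rule_format] assms(2)] assms(2) that by auto
  moreover have "continuous_on T f'" using f'(2) assms(2) by (rule continuous_on_subset)
  ultimately show ?thesis by (rule C1_onI)
qed

lemma C1_on_has_frechet_derivative:
  assumes "C1_on f S" "open S" "x \<in> S"
  shows "(f has_derivative frechet_derivative f (at x)) (at x)"
proof -
  obtain f' where "\<forall>x\<in>S. (f has_derivative blinfun_apply (f' x)) (at x within S)"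
    using assms(1) by (rule C1_onE)
  then have "(f has_derivative blinfun_apply (f' x)) (at x within S)"
    using assms(3) ..
  then have "(f has_derivative blinfun_apply (f' x)) (at x)"
    using assms(2,3) by (simp add: at_within_open_NO_MATCH)
  then have "f differentiable (at x)" by (rule differentiableI)
  then show ?thesis by (simp add: frechet_derivative_works)
qed

lemma C1_on_imp_continuous_on:
  assumes "C1_on f S" shows "continuous_on S f"
proof -
  obtain f' where "\<forall>x\<in>S. (f has_derivative blinfun_apply (f' x)) (at x within S)"
    using assms by (rule C1_onE)
  then show ?thesis
    using has_derivative_continuous_on[of S f "\<lambda>x. blinfun_apply (f' x)"] by simp
qed

text \<open>The derivatives witnessing \<open>C1_on\<close> on the pieces \<open>T\<close> need not
  be related a priori. On open sets derivatives are unique, so all of them agree with the Frechet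
  derivative, which serves as the global witness.\<close>

lemma C1_on_open_cover:
  assumes "\<And>x. x \<in> S \<Longrightarrow> \<exists>T. open T \<and> x \<in> T \<and> T \<subseteq> S \<and> C1_on f T"
  shows "C1_on f S"
proof -
  define f' where "f' x = Blinfun (frechet_derivative f (at x))" for x
  have *: "(f has_derivative blinfun_apply (f' x)) (at x) \<and> isCont f' x" if x: "x \<in> S" for x
  proof -
    obtain T where T: "open T" "x \<in> T" "T \<subseteq> S" "C1_on f T"
      using assms[OF x] by auto
    from T(4) obtain g
      where g: "\<forall>y\<in>T. (f has_derivative blinfun_apply (g y)) (at y within T)"
        "continuous_on T g"
      by (rule C1_onE)
    have fg: "f' y = g y" if "y \<in> T" for y
    proof -
      have "(f has_derivative blinfun_apply (g y)) (at y)"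
        using g(1)[rule_format, OF that] T(1) that by (simp add: at_within_open_NO_MATCH)
      then have "frechet_derivative f (at y) = blinfun_apply (g y)"
        by (metis frechet_derivative_at)
      then show ?thesis by (simp add: f'_def blinfun_apply_inverse)
    qed
    have "continuous_on T f'" using g(2) fg by (simp cong: continuous_on_cong)
    then show ?thesis
      using g(1)[rule_format, OF T(2)] T(1,2) fg[OF T(2)]
      by (simp add: at_within_open_NO_MATCH continuous_on_eq_continuous_at)
  qed
  show ?thesis
  proof (rule C1_onI)
    show "(f has_derivative blinfun_apply (f' x)) (at x within S)" if "x \<in> S" for x
      using * that by (blast intro: has_derivative_at_withinI)
    show "continuous_on S f'"
      using * by (simp add: continuous_at_imp_continuous_on)
  qed
qed

lemma C1_on_imp_GDERIV:
  assumes "C1_on f S" "open S" "x \<in> S"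
  shows "GDERIV f x :> grad f x"
proof -
  have d: "(f has_derivative frechet_derivative f (at x)) (at x)"
    using C1_on_has_frechet_derivative[OF assms] .
  interpret linear "frechet_derivative f (at x)"
    using d has_derivative_linear by blast
  have "frechet_derivative f (at x) h = h \<bullet> grad f x" for h
  proof -
    have "frechet_derivative f (at x) h = frechet_derivative f (at x) (\<Sum>i\<in>Basis. (h \<bullet> i) *\<^sub>R i)"
      by (simp add: euclidean_representation)
    also have "\<dots> = h \<bullet> grad f x"
      by (simp add: sum scale grad_def inner_sum_right mult.commute)
    finally show ?thesis .
  qed
  then show ?thesis using d unfolding gderiv_def by (metis (no_types, lifting) ext)
qed

text \<open>The map \<open>blinfun_inner_left\<close> from vectors to functionals is bounded linear,
  so continuity of the gradient field passes to the derivative in operator norm.\<close>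

lemma C1_onI_GDERIV:
  assumes "\<And>x. x \<in> S \<Longrightarrow> GDERIV f x :> F x" "continuous_on S F"
  shows "C1_on f S"
proof (rule C1_onI)
  show "continuous_on S (\<lambda>x. blinfun_inner_left (F x))"
    by (intro bounded_linear.continuous_on[OF bounded_linear_blinfun_inner_left] assms)
  show "(f has_derivative blinfun_apply (blinfun_inner_left (F x))) (at x within S)" if "x \<in> S" for x
    using assms(1)[OF that] unfolding gderiv_def
    by (auto simp: blinfun_inner_left.rep_eq intro: has_derivative_at_withinI)
qed

lemma C1_on_const [simp]: "C1_on (\<lambda>x. k) S"
proof (rule C1_onI)
  show "((\<lambda>x. k) has_derivative blinfun_apply ((\<lambda>x. 0) x)) (at x within S)" for x
    by (simp add: zero_blinfun.rep_eq)
  show "continuous_on S (\<lambda>x. 0)" by simp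
qed

lemma C1_on_scaleR:
  assumes "C1_on F S" shows "C1_on (\<lambda>x. c *\<^sub>R F x) S"
proof -
  obtain F' where "\<forall>x\<in>S. (F has_derivative blinfun_apply (F' x)) (at x within S)"
    "continuous_on S F'"
    using assms by (rule C1_onE)
  then show ?thesis
    by (intro C1_onI[of S _ "\<lambda>x. c *\<^sub>R F' x"])
      (auto simp: scaleR_blinfun.rep_eq intro!: continuous_intros has_derivative_scaleR_right)
qed

lemma divergence_scaleR:
  assumes "C1_on F S" "open S" "x \<in> S"
  shows "divergence (\<lambda>y. c *\<^sub>R F y) x = c * divergence F x"
proof -
  have "((\<lambda>y. c *\<^sub>R F y) has_derivative (\<lambda>h. c *\<^sub>R frechet_derivative F (at x) h)) (at x)"
    using C1_on_has_frechet_derivative[OF assms] by (rule has_derivative_scaleR_right)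
  then have "frechet_derivative (\<lambda>y. c *\<^sub>R F y) (at x) = (\<lambda>h. c *\<^sub>R frechet_derivative F (at x) h)"
    by (metis frechet_derivative_at)
  then show ?thesis by (simp add: divergence_def sum_distrib_left)
qed

text \<open>The interior conditions of \<open>mixed_laplace_solution\<close>, isolated so that they
  can be restricted to components and balls and glued together again.\<close>

definition harmonic_on :: "('a::euclidean_space \<Rightarrow> real) \<Rightarrow> 'a set \<Rightarrow> bool" where
  "harmonic_on f S \<longleftrightarrow> C1_on f S \<and> C1_on (grad f) S \<and> (\<forall>x\<in>S. laplacian f x = 0)"

lemma harmonic_on_subset:
  assumes "harmonic_on f S" "T \<subseteq> S" shows "harmonic_on f T"
  using assms C1_on_subset[of f S T] C1_on_subset[of "grad f" S T] by (auto simp: harmonic_on_def)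

lemma harmonic_on_cong:
  assumes "harmonic_on f S" "open S" "\<And>y. y \<in> S \<Longrightarrow> f y = g y"
  shows "harmonic_on g S"
proof -
  have gr: "grad f x = grad g x" if "x \<in> S" for x
    using grad_cong_open[OF assms(2) that assms(3)] .
  then have "laplacian f x = laplacian g x" if "x \<in> S" for x
    unfolding laplacian_def using divergence_cong_open[OF assms(2) that, of "grad f" "grad g"] by simp
  then show ?thesis
    using assms(1) C1_on_cong[of f S g] C1_on_cong[of "grad f" S "grad g"] assms(3) gr
    unfolding harmonic_on_def by simp
qed

text \<open>Serves to glue the truncated function, whose harmonicity is proved one component at a
  time.\<close>

lemma harmonic_on_open_cover:
  assumes "\<And>x. x \<in> S \<Longrightarrow> \<exists>T. open T \<and> x \<in> T \<and> T \<subseteq> S \<and> harmonic_on f T"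
  shows "harmonic_on f S"
proof -
  have "C1_on f S" "C1_on (grad f) S"
    by (rule C1_on_open_cover, use assms in \<open>force simp: harmonic_on_def\<close>)+
  moreover have "laplacian f x = 0" if "x \<in> S" for x
    using assms[OF that] by (auto simp: harmonic_on_def)
  ultimately show ?thesis by (simp add: harmonic_on_def)
qed

lemma harmonic_on_scaleR:
  assumes "harmonic_on f S" "open S"
  shows "harmonic_on (\<lambda>x. c * f x) S"
proof -
  have C1: "C1_on f S" and C2: "C1_on (grad f) S" and l: "\<forall>x\<in>S. laplacian f x = 0"
    using assms(1) unfolding harmonic_on_def by auto
  have gr: "c *\<^sub>R grad f x = grad (\<lambda>x. c * f x) x" if "x \<in> S" for x
  proof -
    have "GDERIV (\<lambda>x. c * f x) x :> c *\<^sub>R grad f x"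
      using GDERIV_mult[OF GDERIV_const[of c] C1_on_imp_GDERIV[OF C1 assms(2) that]] by simp
    then show ?thesis by (simp add: grad_eq_GDERIV)
  qed
  have "laplacian (\<lambda>x. c * f x) x = c * laplacian f x" if "x \<in> S" for x
  proof -
    have "divergence (grad (\<lambda>x. c * f x)) x = divergence (\<lambda>y. c *\<^sub>R grad f y) x"
      by (rule divergence_cong_open[OF assms(2) that]) (simp add: gr)
    then show ?thesis
      using divergence_scaleR[OF C2 assms(2) that, of c] by (simp add: laplacian_def)
  qed
  then show ?thesis unfolding harmonic_on_def
    using C1_on_scaleR[OF C1, of c] C1_on_cong[OF C1_on_scaleR[OF C2, of c] gr] l by auto
qed

lemma harmonic_on_const: "harmonic_on (\<lambda>x. k) S"
proof -
  have 0: "grad (\<lambda>x::'a. k) = (\<lambda>x. 0)"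
    using grad_eq_GDERIV[OF GDERIV_const] by (intro ext)
  show ?thesis unfolding harmonic_on_def laplacian_def 0
    by (simp add: divergence_def)
qed

text \<open>At an interior maximum the gradient vanishes. If \<open>D h \<bullet> h\<close> were
  positive, the derivative of \<open>f\<close> along \<open>h\<close> would become positive right
  after \<open>x\<close>, and \<open>f\<close> would exceed its maximum on a short segment.\<close>

lemma second_derivative_test_max:
  assumes "open S" "x \<in> S" and F: "\<And>y. y \<in> S \<Longrightarrow> GDERIV f y :> F y"
    and D: "(F has_derivative D) (at x)" and max: "\<And>y. y \<in> S \<Longrightarrow> f y \<le> f x"
  shows "D h \<bullet> h \<le> 0"
proof (rule ccontr)
  assume neg: "\<not> D h \<bullet> h \<le> 0"
  have "(\<lambda>h. h \<bullet> F x) = (\<lambda>h. 0)"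
    using differential_zero_maxmin[OF assms(2,1)] F[OF assms(2)] max unfolding gderiv_def by blast
  then have Fx: "F x \<bullet> h = 0" by (metis inner_commute)
  have "((\<lambda>t. x + t *\<^sub>R h) has_derivative (\<lambda>t. t *\<^sub>R h)) (at 0)"
    by (auto intro!: derivative_eq_intros)
  from has_derivative_compose[OF this] D
  have "((\<lambda>t. F (x + t *\<^sub>R h)) has_derivative (\<lambda>t. D (t *\<^sub>R h))) (at 0)" by simp
  from has_derivative_inner_left[OF this]
  have "((\<lambda>t. F (x + t *\<^sub>R h) \<bullet> h) has_derivative (\<lambda>t. D (t *\<^sub>R h) \<bullet> h)) (at 0)" .
  moreover have "(\<lambda>t. D (t *\<^sub>R h) \<bullet> h) = (*) (D h \<bullet> h)"
    using D has_derivative_linear[THEN linear_scale] by (fastforce simp: mult.commute)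
  ultimately have "((\<lambda>t. F (x + t *\<^sub>R h) \<bullet> h) has_real_derivative (D h \<bullet> h)) (at 0)"
    by (simp add: has_field_derivative_def)
  from DERIV_pos_inc_right[OF this] neg Fx obtain d
    where d: "d > 0" "\<And>t. 0 < t \<Longrightarrow> t < d \<Longrightarrow> 0 < F (x + t *\<^sub>R h) \<bullet> h"
    by (force simp: algebra_simps)
  have "isCont (\<lambda>t. x + t *\<^sub>R h) 0" by (intro continuous_intros)
  then have "eventually (\<lambda>t. x + t *\<^sub>R h \<in> S) (at 0)"
    using assms(1,2) unfolding isCont_def by (auto dest: topological_tendstoD)
  then obtain e where e: "e > 0" "\<And>t. t \<noteq> 0 \<Longrightarrow> \<bar>t\<bar> < e \<Longrightarrow> x + t *\<^sub>R h \<in> S"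
    unfolding eventually_at by (auto simp: dist_real_def)
  \<comment> \<open>Halving keeps \<open>T\<close> strictly below both \<open>d\<close>, where the
    directional derivative is positive, and \<open>e\<close>, where the segment stays in
    \<open>S\<close>.\<close>
  define T where "T = min d e / 2"
  have T: "0 < T" "T < d" "T < e" using d(1) e(1) by (auto simp: T_def min_def)
  have inS: "x + t *\<^sub>R h \<in> S" if "0 \<le> t" "t \<le> T" for t
    using e(2)[of t] assms(2) that T by (cases "t = 0") auto
  have der: "((\<lambda>t. f (x + t *\<^sub>R h)) has_real_derivative F (x + t *\<^sub>R h) \<bullet> h) (at t)"
    if "0 \<le> t" "t \<le> T" for t
  proof -
    have 1: "((\<lambda>t. x + t *\<^sub>R h) has_derivative (\<lambda>t. t *\<^sub>R h)) (at t)"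
      by (auto intro!: derivative_eq_intros)
    have "((\<lambda>t. f (x + t *\<^sub>R h)) has_derivative (\<lambda>s. (s *\<^sub>R h) \<bullet> F (x + t *\<^sub>R h))) (at t)"
      using has_derivative_compose[OF 1 F[OF inS[OF that], unfolded gderiv_def]] .
    moreover have "(\<lambda>s. (s *\<^sub>R h) \<bullet> F (x + t *\<^sub>R h)) = (*) (F (x + t *\<^sub>R h) \<bullet> h)"
      by (simp add: fun_eq_iff inner_commute mult.commute)
    ultimately show ?thesis by (simp add: has_field_derivative_def)
  qed
  have "f (x + 0 *\<^sub>R h) < f (x + T *\<^sub>R h)"
  proof (rule DERIV_pos_imp_increasing_open[OF T(1)])
    show "continuous_on {0..T} (\<lambda>t. f (x + t *\<^sub>R h))"
      by (intro continuous_at_imp_continuous_on ballI DERIV_isCont[OF der]) auto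
    show "\<exists>y. ((\<lambda>t. f (x + t *\<^sub>R h)) has_real_derivative y) (at t) \<and> 0 < y"
      if "0 < t" "t < T" for t
      using der[of t] d(2)[of t] that T by auto
  qed
  then show False using max[OF inS[of T]] T by simp
qed

section \<open>The maximum principle\<close>

text \<open>A quadratic polynomial vanishing at \<open>p\<close> with gradient
  \<open>A *\<^sub>R e\<close> there. For \<open>A > 0\<close> and a unit vector \<open>e\<close>,
  its nonnegative set near \<open>p\<close> lies, apart from \<open>p\<close>, in the open ball of
  radius \<open>A\<close> around \<open>p + A *\<^sub>R e\<close>.\<close>

definition barrier :: "'a::euclidean_space \<Rightarrow> 'a \<Rightarrow> real \<Rightarrow> 'a \<Rightarrow> real" where
  "barrier p e A x =
     A * ((x - p) \<bullet> e) + (real DIM('a) + 1) * ((x - p) \<bullet> e)\<^sup>2 - (x - p) \<bullet> (x - p)"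

definition barrier_grad :: "'a::euclidean_space \<Rightarrow> 'a \<Rightarrow> real \<Rightarrow> 'a \<Rightarrow> 'a" where
  "barrier_grad p e A x = (A + 2 * (real DIM('a) + 1) * ((x - p) \<bullet> e)) *\<^sub>R e - 2 *\<^sub>R (x - p)"

lemma barrier_self [simp]: "barrier p e A p = 0"
  by (simp add: barrier_def)

lemma continuous_on_barrier: "continuous_on S (barrier p e A)"
  unfolding barrier_def by (intro continuous_intros)

lemma GDERIV_barrier: "GDERIV (barrier p e A) x :> barrier_grad p e A x"
  unfolding gderiv_def barrier_def barrier_grad_def
  by (rule derivative_eq_intros refl)+
     (simp add: fun_eq_iff algebra_simps inner_commute)

lemma has_derivative_barrier_grad:
  "(barrier_grad p e A has_derivative
     (\<lambda>h. (2 * (real DIM('a) + 1) * (h \<bullet> e)) *\<^sub>R e - 2 *\<^sub>R h)) (at (x::'a::euclidean_space))"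
  unfolding barrier_grad_def
  by (auto intro!: derivative_eq_intros simp: fun_eq_iff)

text \<open>The factor \<open>DIM('a) + 1\<close> in the barrier makes its Laplacian equal to 2, hence
  positive.\<close>

lemma harmonic_add_barrier_no_max:
  fixes f :: "'a::euclidean_space \<Rightarrow> real"
  assumes "harmonic_on f S" "open S" "x \<in> S" "norm e = 1" "\<epsilon> > 0"
  shows "\<exists>y\<in>S. f x + \<epsilon> * barrier p e A x < f y + \<epsilon> * barrier p e A y"
proof (rule ccontr)
  assume "\<not> ?thesis"
  then have max: "f y + \<epsilon> * barrier p e A y \<le> f x + \<epsilon> * barrier p e A x" if "y \<in> S" for y
    using that by force
  have C1: "C1_on f S" and C2: "C1_on (grad f) S" and l: "laplacian f x = 0"
    using assms(1,3) unfolding harmonic_on_def by auto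
  let ?F = "\<lambda>y. grad f y + \<epsilon> *\<^sub>R barrier_grad p e A y"
  let ?L = "frechet_derivative (grad f) (at x)"
  let ?D = "\<lambda>h. ?L h + \<epsilon> *\<^sub>R ((2 * (real DIM('a) + 1) * (h \<bullet> e)) *\<^sub>R e - 2 *\<^sub>R h)"
  have F: "GDERIV (\<lambda>y. f y + \<epsilon> * barrier p e A y) y :> ?F y" if "y \<in> S" for y
    using GDERIV_add[OF C1_on_imp_GDERIV[OF C1 assms(2) that]
        GDERIV_mult[OF GDERIV_const[of \<epsilon>] GDERIV_barrier[of p e A y]]] by simp
  have D: "(?F has_derivative ?D) (at x)"
    by (intro has_derivative_add has_derivative_scaleR_right has_derivative_barrier_grad
        C1_on_has_frechet_derivative[OF C2 assms(2,3)])
  \<comment> \<open>The trace of \<open>?D\<close> is nonpositive at a maximum. With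
    \<open>N\<close> the dimension it also equals 0 plus
    \<open>\<epsilon> * (2 * (N + 1) - 2 * N)\<close>, which is positive.\<close>
  have "(\<Sum>i\<in>Basis. ?D i \<bullet> i) \<le> 0"
    by (intro sum_nonpos second_derivative_test_max[OF assms(2,3) F D max])
  moreover have "(\<Sum>i\<in>Basis. ?D i \<bullet> i) = (\<Sum>i\<in>Basis. ?L i \<bullet> i)
      + \<epsilon> * (2 * (real DIM('a) + 1) * (\<Sum>i\<in>Basis. (e \<bullet> i)\<^sup>2) - 2 * (\<Sum>i\<in>(Basis::'a set). i \<bullet> i))"
  proof -
    have "?D i \<bullet> i = ?L i \<bullet> i
        + \<epsilon> * (2 * (real DIM('a) + 1) * (e \<bullet> i)\<^sup>2 - 2 * (i \<bullet> i))" for i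
      by (simp add: inner_add_left inner_diff_left power2_eq_square inner_commute[of i e])
    then show ?thesis
      by (simp only: sum.distrib sum_subtractf flip: sum_distrib_left)
  qed
  moreover have "(\<Sum>i\<in>Basis. ?L i \<bullet> i) = 0"
    using l by (simp add: laplacian_def divergence_def)
  moreover have "(\<Sum>i\<in>Basis. (e \<bullet> i)\<^sup>2) = 1"
    using euclidean_inner[of e e] assms(4) by (simp add: power2_eq_square norm_eq_1)
  moreover have "(\<Sum>i\<in>(Basis::'a set). i \<bullet> i) = real DIM('a)"
    by simp
  ultimately show False using assms(5) by (simp add: algebra_simps)
qed

text \<open>On the compact part where \<open>g\<close> is nonnegative, \<open>f\<close> stays below
  \<open>M\<close> by a fixed margin \<open>\<delta>\<close>, and a multiple of the bounded
  \<open>g\<close> with factor \<open>\<delta> / (2 * B)\<close> uses up at most half of it.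
  Elsewhere the perturbation only lowers \<open>f\<close>.\<close>

lemma compact_small_perturbation:
  fixes f g :: "'a::topological_space \<Rightarrow> real"
  assumes "compact K" "continuous_on K f" "continuous_on K g"
    and "\<And>x. x \<in> K \<Longrightarrow> f x \<le> M" "\<And>x. x \<in> K \<Longrightarrow> 0 \<le> g x \<Longrightarrow> f x < M"
  shows "\<exists>\<epsilon>>0. \<forall>x\<in>K. f x + \<epsilon> * g x < M"
proof -
  define P where "P = K \<inter> g -` {0..}"
  have "closedin (top_of_set K) P"
    unfolding P_def by (intro continuous_closedin_preimage assms) simp
  then have P: "compact P" using assms(1) closedin_compact by blast
  obtain B where B: "\<And>x. x \<in> K \<Longrightarrow> \<bar>g x\<bar> \<le> B" "B > 0"
  proof -
    have "bounded (g ` K)" by (intro compact_imp_bounded compact_continuous_image assms)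
    then show thesis using that unfolding bounded_pos by auto
  qed
  obtain \<delta> where \<delta>: "\<delta> > 0" "\<And>x. x \<in> P \<Longrightarrow> f x \<le> M - \<delta>"
  proof (cases "P = {}")
    case True
    \<comment> \<open>No point has to respect the margin here; 1 is an arbitrary positive
      value.\<close>
    then show thesis using that[of 1] by simp
  next
    case False
    have "continuous_on P f" using assms(2) continuous_on_subset P_def by blast
    then obtain y where y: "y \<in> P" "\<And>x. x \<in> P \<Longrightarrow> f x \<le> f y"
      using continuous_attains_sup[OF P False] by blast
    then have "f y < M" using assms(5) by (simp add: P_def)
    then show thesis using that[of "M - f y"] y(2) by simp
  qed
  have "f x + \<delta> / (2 * B) * g x < M" if x: "x \<in> K" for x
  proof (cases "0 \<le> g x")
    case True
    then have "f x \<le> M - \<delta>" using \<delta>(2) x by (simp add: P_def)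
    moreover have "\<delta> / (2 * B) * g x \<le> \<delta> / (2 * B) * B"
      using B(1)[OF x] B(2) \<delta>(1) by (intro mult_left_mono) auto
    ultimately show ?thesis using B(2) \<delta>(1) by simp
  next
    case False
    then have "\<delta> / (2 * B) * g x < 0"
      using B(2) \<delta>(1) by (intro mult_pos_neg) auto
    then show ?thesis using assms(4)[OF x] by simp
  qed
  then show ?thesis using \<delta>(1) B(2) by (intro exI[of _ "\<delta> / (2 * B)"]) simp
qed

text \<open>A sphere around a point \<open>p\<close> that touches the maximum set from outside contradicts
  \<open>harmonic_add_barrier_no_max\<close> near the touching point: there the barrier is nonnegative
  only inside that sphere.\<close>

lemma harmonic_strong_max_principle:
  fixes f :: "'a::euclidean_space \<Rightarrow> real"
  assumes "harmonic_on f C" "open C" "connected C"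
    and le: "\<And>x. x \<in> C \<Longrightarrow> f x \<le> M" and "q \<in> C" "f q = M" "x \<in> C"
  shows "f x = M"
proof -
  have cont: "continuous_on C f"
    using assms(1) C1_on_imp_continuous_on unfolding harmonic_on_def by blast
  define E where "E = {x \<in> C. f x = M}"
  have clo: "closedin (top_of_set C) E"
    unfolding E_def by (rule continuous_closedin_preimage_constant[OF cont])
  \<comment> \<open>Openness of the maximum set \<open>E\<close>; with closedness and connectedness
    it gives \<open>E = C\<close>.\<close>
  have "\<exists>r>0. ball x0 r \<subseteq> E" if x0: "x0 \<in> E" for x0
  proof -
    obtain s where s: "s > 0" "ball x0 s \<subseteq> C"
      using x0 assms(2) unfolding E_def open_contains_ball by blast
    \<comment> \<open>With half the radius, the closed ball of radius \<open>s/2\<close> around any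
      such point \<open>p\<close> still lies in \<open>C\<close> and contains
      \<open>x0\<close>.\<close>
    have "ball x0 (s/2) \<subseteq> E"
    proof
      fix p assume p: "p \<in> ball x0 (s/2)"
      show "p \<in> E"
      proof (rule ccontr)
        assume pE: "p \<notin> E"
        have sub: "cball p (s/2) \<subseteq> C"
        proof
          fix y assume "y \<in> cball p (s/2)"
          then have "dist x0 y < s"
            using p dist_triangle[of x0 y p] by simp
          then show "y \<in> C" using s(2) by auto
        qed
        define K where "K = {y \<in> cball p (s/2). f y = M}"
        have "closed K"
          unfolding K_def using continuous_on_subset[OF cont sub]
          by (intro continuous_closed_preimage_constant) auto
        moreover have x0K: "x0 \<in> K" using x0 p by (simp add: K_def E_def dist_commute)
        \<comment> \<open>\<open>y\<close> is a maximum point nearest to \<open>p\<close>, so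
          \<open>f\<close> stays below \<open>M\<close> in the open ball around \<open>p\<close>
          whose sphere passes through \<open>y\<close>.\<close>
        ultimately obtain y where y: "y \<in> K" "\<And>z. z \<in> K \<Longrightarrow> dist p y \<le> dist p z"
          using distance_attains_inf[of K p] by auto
        define R where "R = dist p y"
        have yC: "y \<in> C" "f y = M" using y(1) sub by (auto simp: K_def)
        have R: "R > 0" "R < s/2"
          using yC pE y(2)[OF x0K] p by (auto simp: R_def E_def dist_commute)
        have inside: "f z < M" if "dist p z < R" for z
        proof -
          have "z \<in> cball p (s/2)" using that R(2) by simp
          moreover have "z \<notin> K" using y(2)[of z] that R_def by auto
          ultimately show ?thesis using le[of z] sub by (force simp: K_def)
        qed
        define e where "e = (p - y) /\<^sub>R R"
        have e: "norm e = 1" using R(1) by (simp add: e_def R_def dist_norm)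
        \<comment> \<open>The first bound makes the quadratic term of the barrier smaller than its
          linear term, the second keeps \<open>cball y \<rho>\<close> inside
          \<open>cball p (s/2)\<close>.\<close>
        define \<rho> where "\<rho> = min (R / (2 * (real DIM('a) + 1))) (s/2 - R)"
        have "R / (2 * (real DIM('a) + 1)) > 0" using R(1) by simp
        then have \<rho>: "\<rho> > 0" "\<rho> \<le> R / (2 * (real DIM('a) + 1))" "\<rho> \<le> s/2 - R"
          using R unfolding \<rho>_def by auto
        then have \<rho>': "(real DIM('a) + 1) * \<rho> < R"
          using R(1) by (simp add: field_simps)
        have ball_C: "cball y \<rho> \<subseteq> C"
        proof
          fix z assume "z \<in> cball y \<rho>"
          then have "z \<in> cball p (s/2)"
            using dist_triangle[of p z y] \<rho>(3) by (simp add: R_def)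
          then show "z \<in> C" using sub by blast
        qed
        have touch: "f z < M" if z: "z \<in> sphere y \<rho>" and g: "0 \<le> barrier y e R z" for z
        proof (rule inside)
          define d where "d = z - y"
          define t where "t = d \<bullet> e"
          have nd: "norm d = \<rho>" using z by (simp add: d_def dist_norm norm_minus_commute)
          have t: "\<bar>t\<bar> \<le> \<rho>" using Cauchy_Schwarz_ineq2[of d e] nd e by (simp add: t_def)
          have g': "\<rho>\<^sup>2 \<le> t * (R + (real DIM('a) + 1) * t)"
            using g nd by (simp add: barrier_def flip: d_def t_def power2_norm_eq_inner)
              (simp add: algebra_simps power2_eq_square)
          have small: "\<bar>(real DIM('a) + 1) * t\<bar> < R"
          proof -
            have "\<bar>(real DIM('a) + 1) * t\<bar> = (real DIM('a) + 1) * \<bar>t\<bar>" by (simp add: abs_mult)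
            also have "\<dots> \<le> (real DIM('a) + 1) * \<rho>" using t by (intro mult_left_mono) auto
            finally show ?thesis using \<rho>' by simp
          qed
          have "0 < t * (R + (real DIM('a) + 1) * t)"
            using g' \<rho>(1) by (meson less_le_trans zero_less_power)
          then have "t > 0" using small by (auto simp: zero_less_mult_iff)
          \<comment> \<open>The resulting bound \<open>\<rho>\<^sup>2 < 2 * R * t\<close> says
            exactly that \<open>z\<close> is closer than \<open>R\<close> to the centre
            \<open>p = y + R *\<^sub>R e\<close>.\<close>
          then have "t * (R + (real DIM('a) + 1) * t) < t * (2 * R)"
            using small by (intro mult_strict_left_mono) auto
          with g' have "\<rho>\<^sup>2 < 2 * R * t" by (simp only: mult_ac)
          moreover have "(dist p z)\<^sup>2 = \<rho>\<^sup>2 - 2 * R * t + R\<^sup>2"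
          proof -
            have pz: "p - z = R *\<^sub>R e - d" using R(1) by (simp add: e_def d_def)
            have ee: "e \<bullet> e = 1" using e by (simp add: norm_eq_1)
            have "(dist p z)\<^sup>2 = (R *\<^sub>R e - d) \<bullet> (R *\<^sub>R e - d)"
              by (simp add: dist_norm pz power2_norm_eq_inner)
            also have "\<dots> = R\<^sup>2 * (e \<bullet> e) - 2 * R * (d \<bullet> e) + d \<bullet> d"
              by (simp add: inner_diff_left inner_diff_right inner_commute power2_eq_square)
            finally show ?thesis
              using nd ee by (simp add: t_def flip: power2_norm_eq_inner)
          qed
          ultimately have "(dist p z)\<^sup>2 < R\<^sup>2" by simp
          then show "dist p z < R" using R(1) by (simp add: power2_less_imp_less)
        qed
        obtain \<epsilon> where \<epsilon>: "\<epsilon> > 0" "\<forall>z\<in>sphere y \<rho>. f z + \<epsilon> * barrier y e R z < M"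
        proof -
          have "sphere y \<rho> \<subseteq> C" using ball_C by auto
          then have "\<exists>\<epsilon>>0. \<forall>z\<in>sphere y \<rho>. f z + \<epsilon> * barrier y e R z < M"
            using le touch
            by (intro compact_small_perturbation continuous_on_barrier continuous_on_subset[OF cont]) auto
          then show thesis using that by blast
        qed
        have "continuous_on (cball y \<rho>) (\<lambda>z. f z + \<epsilon> * barrier y e R z)"
          by (intro continuous_intros continuous_on_barrier continuous_on_subset[OF cont ball_C])
        moreover have "cball y \<rho> \<noteq> {}" using \<rho>(1) by simp
        ultimately obtain m where m: "m \<in> cball y \<rho>"
          "\<And>z. z \<in> cball y \<rho> \<Longrightarrow> f z + \<epsilon> * barrier y e R z \<le> f m + \<epsilon> * barrier y e R m"
          using continuous_attains_sup[OF compact_cball] by blast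
        \<comment> \<open>The barrier vanishes at \<open>y\<close>, so the maximum is at least
          \<open>M\<close> and cannot be attained on the sphere; an interior maximum is impossible
          too.\<close>
        have "M \<le> f m + \<epsilon> * barrier y e R m" using m(2)[of y] \<rho>(1) yC by simp
        then have "m \<notin> sphere y \<rho>" using \<epsilon>(2) by force
        then have "m \<in> ball y \<rho>" using m(1) by auto
        moreover have "harmonic_on f (ball y \<rho>)"
          using assms(1) ball_C harmonic_on_subset ball_subset_cball by blast
        ultimately obtain z where "z \<in> ball y \<rho>"
          "f m + \<epsilon> * barrier y e R m < f z + \<epsilon> * barrier y e R z"
          using harmonic_add_barrier_no_max[OF _ open_ball _ e \<epsilon>(1)] by blast
        then show False using m(2)[of z] by auto
      qed
    qed
    then show ?thesis using s(1) by (intro exI[of _ "s/2"]) simp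
  qed
  then have "open E" unfolding open_contains_ball by blast
  then have "openin (top_of_set C) E" by (intro open_subset) (auto simp: E_def)
  then have "E = C" using clo assms(3,5,6) unfolding connected_clopen E_def by blast
  then show ?thesis using assms(7) by (auto simp: E_def)
qed

section \<open>Boundary geometry: outward normals, interior cones and components\<close>

lemma outward_unit_normal_norm: "outward_unit_normal \<Omega> x \<nu> \<Longrightarrow> norm \<nu> = 1"
  unfolding outward_unit_normal_def by auto

text \<open>The defining function is nonnegative at \<open>x\<close>, which is not in the open set
  \<open>\<Omega>\<close>, and its derivative along \<open>h\<close> is a positive multiple of
  \<open>h \<bullet> \<nu>\<close>. Hence it is positive right after \<open>x\<close>.\<close>

lemma outward_unit_normal_exterior:
  assumes "outward_unit_normal \<Omega> x \<nu>" "open \<Omega>" "0 < h \<bullet> \<nu>"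
  shows "eventually (\<lambda>t. x + t *\<^sub>R h \<notin> \<Omega>) (at_right 0)"
proof -
  obtain V \<phi> where V: "x \<in> frontier \<Omega>" "open V" "x \<in> V" "C1_on \<phi> V" "grad \<phi> x \<noteq> 0"
    "\<Omega> \<inter> V = {y \<in> V. \<phi> y < 0}" "\<nu> = grad \<phi> x /\<^sub>R norm (grad \<phi> x)"
    using assms(1) unfolding outward_unit_normal_def by auto
  have "x \<notin> \<Omega>" using V(1) assms(2) by (simp add: frontier_def interior_open)
  then have \<phi>x: "0 \<le> \<phi> x" using V(3,6) by force
  have pos: "0 < h \<bullet> grad \<phi> x" using assms(3) V(5,7) by (simp add: zero_less_mult_iff)
  have "((\<lambda>t. x + t *\<^sub>R h) has_derivative (\<lambda>t. t *\<^sub>R h)) (at 0)"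
    by (auto intro!: derivative_eq_intros)
  from has_derivative_compose[OF this, of \<phi> "\<lambda>h. h \<bullet> grad \<phi> x"]
  have "((\<lambda>t. \<phi> (x + t *\<^sub>R h)) has_derivative (\<lambda>t. (t *\<^sub>R h) \<bullet> grad \<phi> x)) (at 0)"
    using C1_on_imp_GDERIV[OF V(4,2,3)] by (simp add: gderiv_def)
  moreover have "(\<lambda>t. (t *\<^sub>R h) \<bullet> grad \<phi> x) = (*) (h \<bullet> grad \<phi> x)"
    by (simp add: fun_eq_iff mult.commute)
  ultimately have "((\<lambda>t. \<phi> (x + t *\<^sub>R h)) has_real_derivative h \<bullet> grad \<phi> x) (at 0)"
    by (simp add: has_field_derivative_def)
  from DERIV_pos_inc_right[OF this pos]
  obtain d where d: "d > 0" "\<And>t. 0 < t \<Longrightarrow> t < d \<Longrightarrow> \<phi> x < \<phi> (x + t *\<^sub>R h)"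
    by auto
  have "eventually (\<lambda>t. 0 < t \<and> t < d) (at_right 0)"
    using d(1) by (auto simp: eventually_at_right)
  moreover have "((\<lambda>t. x + t *\<^sub>R h) \<longlongrightarrow> x + 0 *\<^sub>R h) (at_right 0)" by (intro tendsto_intros)
  then have "eventually (\<lambda>t. x + t *\<^sub>R h \<in> V) (at_right 0)"
    using V(2,3) by (auto dest: topological_tendstoD)
  ultimately show ?thesis
  proof eventually_elim
    case (elim t)
    then have "\<not> \<phi> (x + t *\<^sub>R h) < 0" using d(2)[of t] \<phi>x by simp
    then show ?case using elim(2) V(6) by blast
  qed
qed

text \<open>The radius is uniform in the apex \<open>p\<close>. Continuity of the derivative of
  \<open>\<phi>\<close> keeps \<open>\<phi> y - \<phi> p\<close> within
  \<open>\<eta> * \<kappa> * norm (y - p)\<close> of its linearization at \<open>x\<close>, and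
  \<open>\<phi>\<close> is at most 0 on \<open>closure \<Omega>\<close> near \<open>x\<close>, so
  \<open>\<phi>\<close> is negative in the cone.\<close>

lemma outward_unit_normal_interior_cone:
  assumes "outward_unit_normal \<Omega> x \<nu>" "open \<Omega>" "\<eta> > 0"
  shows "\<exists>r>0. \<forall>p\<in>closure \<Omega> \<inter> ball x r. \<forall>y\<in>ball x r.
    (y - p) \<bullet> \<nu> < - \<eta> * norm (y - p) \<longrightarrow> y \<in> \<Omega>"
proof -
  obtain V \<phi> where V: "x \<in> frontier \<Omega>" "open V" "x \<in> V" "C1_on \<phi> V" "grad \<phi> x \<noteq> 0"
    "\<Omega> \<inter> V = {y \<in> V. \<phi> y < 0}" "\<nu> = grad \<phi> x /\<^sub>R norm (grad \<phi> x)"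
    using assms(1) unfolding outward_unit_normal_def by auto
  define \<kappa> where "\<kappa> = norm (grad \<phi> x)"
  have \<kappa>: "\<kappa> > 0" and gr: "grad \<phi> x = \<kappa> *\<^sub>R \<nu>" using V(5,7) by (auto simp: \<kappa>_def)
  obtain f' where f': "\<forall>y\<in>V. (\<phi> has_derivative blinfun_apply (f' y)) (at y within V)"
    "continuous_on V f'"
    using V(4) by (rule C1_onE)
  have "(\<phi> has_derivative blinfun_apply (f' x)) (at x)"
    using f'(1) V(2,3) by (simp add: at_within_open_NO_MATCH)
  then have f'x: "blinfun_apply (f' x) h = \<kappa> * (h \<bullet> \<nu>)" for h
    using C1_on_imp_GDERIV[OF V(4,2,3)] has_derivative_unique gr unfolding gderiv_def
    by (metis inner_scaleR_right)
  have "isCont f' x" using f'(2) V(2,3) by (simp add: continuous_on_eq_continuous_at)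
  then obtain r1 where r1: "r1 > 0" "\<And>y. dist y x < r1 \<Longrightarrow> dist (f' y) (f' x) < \<eta> * \<kappa>"
    unfolding continuous_at_eps_delta using assms(3) \<kappa> by (meson mult_pos_pos)
  obtain r2 where r2: "r2 > 0" "ball x r2 \<subseteq> V" using V(2,3) open_contains_ball by blast
  define r where "r = min r1 r2"
  have r: "r > 0" "ball x r \<subseteq> V" using r1(1) r2 by (auto simp: r_def)
  have cont: "continuous_on V \<phi>" using V(4) by (rule C1_on_imp_continuous_on)
  have "y \<in> \<Omega>" if p: "p \<in> closure \<Omega>" "p \<in> ball x r" and y: "y \<in> ball x r"
      and cone: "(y - p) \<bullet> \<nu> < - \<eta> * norm (y - p)" for p y
  proof -
    have "\<phi> p \<le> 0"
    proof (rule ccontr)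
      assume "\<not> \<phi> p \<le> 0"
      define W where "W = V \<inter> \<phi> -` {0<..}"
      have "open W" unfolding W_def using cont V(2) by (intro continuous_open_preimage) auto
      moreover have "p \<in> W" using \<open>\<not> \<phi> p \<le> 0\<close> p(2) r(2) by (auto simp: W_def)
      ultimately have "W \<inter> \<Omega> \<noteq> {}" using p(1) closure_iff_nhds_not_empty by blast
      then show False using V(6) by (force simp: W_def)
    qed
    moreover have "norm (\<phi> y - \<phi> p - blinfun_apply (f' x) (y - p)) \<le> norm (y - p) * (\<eta> * \<kappa>)"
    proof (rule differentiable_bound_linearization[where S = "ball x r"
          and f' = "\<lambda>y. blinfun_apply (f' y)"])
      show "p + t *\<^sub>R (y - p) \<in> ball x r" if "t \<in> {0..1}" for t
      proof -
        have "p + t *\<^sub>R (y - p) = (1 - t) *\<^sub>R p + t *\<^sub>R y" by (simp add: algebra_simps)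
        then show ?thesis using convexD_alt[OF convex_ball p(2) y] that by auto
      qed
      show "(\<phi> has_derivative blinfun_apply (f' z)) (at z within ball x r)" if "z \<in> ball x r" for z
        using has_derivative_subset[OF f'(1)[rule_format]] that r(2) by blast
      show "onorm (blinfun_apply (f' z) - blinfun_apply (f' x)) \<le> \<eta> * \<kappa>" if "z \<in> ball x r" for z
      proof -
        have "norm (f' z - f' x) < \<eta> * \<kappa>"
          using r1(2)[of z] that by (simp add: r_def dist_commute flip: dist_norm)
        then show ?thesis by (simp add: norm_blinfun.rep_eq minus_blinfun.rep_eq fun_diff_def)
      qed
      show "x \<in> ball x r" using r(1) by simp
    qed
    moreover have "\<kappa> * ((y - p) \<bullet> \<nu>) < \<kappa> * (- \<eta> * norm (y - p))"
      using cone \<kappa> by (intro mult_strict_left_mono)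
    ultimately have "\<phi> y < 0" by (simp add: f'x abs_le_iff algebra_simps)
    then show ?thesis using V(6) y r(2) by blast
  qed
  then show ?thesis using r(1) by (intro exI[of _ r] conjI ballI impI) blast+
qed

text \<open>Cone directions point into \<open>\<Omega>\<close> at \<open>y\<close>, so none of them can make an acute angle with the
  outward normal there; perturbing \<open>h\<close> by a small multiple of \<open>\<mu>\<close> makes the inequality strict.\<close>

lemma inner_normal_in_dual_cone:
  assumes "outward_unit_normal \<Omega> y \<mu>" "open \<Omega>" "r > 0" "\<eta> > 0"
    and cone: "\<And>p z. p \<in> closure \<Omega> \<Longrightarrow> p \<in> ball x\<^sub>0 r \<Longrightarrow> z \<in> ball x\<^sub>0 r \<Longrightarrow>
       \<eta> * norm (z - p) < (z - p) \<bullet> e \<Longrightarrow> z \<in> \<Omega>"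
    and "y \<in> ball x\<^sub>0 r" "norm e = 1" "\<eta> * norm h < h \<bullet> e"
  shows "h \<bullet> \<mu> < 0"
proof -
  have \<mu>: "norm \<mu> = 1" using assms(1) by (rule outward_unit_normal_norm)
  have yc: "y \<in> closure \<Omega>" using assms(1) by (auto simp: outward_unit_normal_def frontier_def)
  have weak: "h \<bullet> \<mu> \<le> 0" if h: "\<eta> * norm h < h \<bullet> e" for h
  proof (rule ccontr)
    assume "\<not> h \<bullet> \<mu> \<le> 0"
    then have "eventually (\<lambda>t. y + t *\<^sub>R h \<notin> \<Omega>) (at_right 0)"
      using outward_unit_normal_exterior[OF assms(1,2)] by simp
    moreover have "((\<lambda>t. y + t *\<^sub>R h) \<longlongrightarrow> y + 0 *\<^sub>R h) (at_right 0)" by (intro tendsto_intros)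
    then have "eventually (\<lambda>t. y + t *\<^sub>R h \<in> ball x\<^sub>0 r) (at_right 0)"
      using assms(6) by (auto dest: topological_tendstoD[OF _ open_ball])
    moreover have "eventually (\<lambda>t. 0 < (t::real)) (at_right 0)"
      by (rule eventually_at_right_less)
    ultimately have "eventually (\<lambda>t::real. False) (at_right 0)"
    proof eventually_elim
      case (elim t)
      have "\<eta> * norm (y + t *\<^sub>R h - y) = t * (\<eta> * norm h)" using elim(3) by simp
      also have "\<dots> < t * (h \<bullet> e)" using h elim(3) by simp
      also have "\<dots> = (y + t *\<^sub>R h - y) \<bullet> e" by simp
      finally show ?case using cone[OF yc assms(6) elim(2)] elim(1) by blast
    qed
    then show False by simp
  qed
  \<comment> \<open>Adding \<open>\<delta> *\<^sub>R \<mu>\<close> to \<open>h\<close> costs at most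
    \<open>\<delta> * (1 + \<eta>)\<close> in the cone inequality; this choice spends half of the
    slack.\<close>
  define \<delta> where "\<delta> = ((h \<bullet> e - \<eta> * norm h) / 2) / (1 + \<eta>)"
  have \<delta>: "\<delta> > 0" "\<delta> * (1 + \<eta>) < h \<bullet> e - \<eta> * norm h"
  proof -
    have "h \<bullet> e - \<eta> * norm h > 0" "1 + \<eta> > 0" using assms(4,8) by simp_all
    moreover from this(2) have "\<delta> * (1 + \<eta>) = (h \<bullet> e - \<eta> * norm h) / 2"
      using \<delta>_def by (metis less_irrefl nonzero_eq_divide_eq)
    ultimately show "\<delta> * (1 + \<eta>) < h \<bullet> e - \<eta> * norm h" by (simp only:) simp
    show "\<delta> > 0" using assms(4,8) by (simp add: \<delta>_def)
  qed
  have "\<eta> * norm (h + \<delta> *\<^sub>R \<mu>) \<le> \<eta> * (norm h + \<delta>)"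
    using norm_triangle_ineq[of h "\<delta> *\<^sub>R \<mu>"] \<mu> \<delta>(1) assms(4) by (intro mult_left_mono) auto
  also have "\<dots> < h \<bullet> e - \<delta>" using \<delta>(2) by (simp add: algebra_simps)
  also have "\<dots> \<le> (h + \<delta> *\<^sub>R \<mu>) \<bullet> e"
  proof -
    have "\<bar>\<mu> \<bullet> e\<bar> \<le> 1" using Cauchy_Schwarz_ineq2[of \<mu> e] \<mu> assms(7) by simp
    then have "\<delta> * (- 1) \<le> \<delta> * (\<mu> \<bullet> e)" using \<delta>(1) by (intro mult_left_mono) auto
    then show ?thesis by (simp add: inner_add_left)
  qed
  finally have "(h + \<delta> *\<^sub>R \<mu>) \<bullet> \<mu> \<le> 0" by (rule weak)
  moreover have "\<mu> \<bullet> \<mu> = 1" using \<mu> by (simp add: norm_eq_1)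
  ultimately show ?thesis using \<delta>(1) by (simp add: inner_add_left)
qed

text \<open>Points of \<open>C\<close> close to \<open>y\<close> are translated along \<open>h\<close> inside \<open>\<Omega>\<close>, hence inside \<open>C\<close>; no local
  connectedness of \<open>\<Omega>\<close> at \<open>y\<close> is needed.\<close>

lemma inward_segment_in_component:
  assumes "C \<in> components \<Omega>" "y \<in> closure C" "y \<in> ball x\<^sub>0 r"
    and cone: "\<And>p z. p \<in> \<Omega> \<Longrightarrow> p \<in> ball x\<^sub>0 r \<Longrightarrow> z \<in> ball x\<^sub>0 r \<Longrightarrow>
       \<eta> * norm (z - p) < (z - p) \<bullet> e \<Longrightarrow> z \<in> \<Omega>"
    and h: "\<eta> * norm h < h \<bullet> e" "norm h = 1"
    and t: "0 < t" "dist x\<^sub>0 y + t < r"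
  shows "y + t *\<^sub>R h \<in> closure C"
  unfolding closure_approachable
proof (intro allI impI)
  fix \<epsilon> :: real assume "\<epsilon> > 0"
  \<comment> \<open>This close to \<open>y\<close>, the translates of \<open>p\<close> along
    \<open>h\<close> up to length \<open>t\<close> stay in the ball, and the last one is
    \<open>\<epsilon>\<close>-close to the target.\<close>
  then have "min \<epsilon> (r - dist x\<^sub>0 y - t) > 0" using t by simp
  then obtain p where p: "p \<in> C" "dist p y < min \<epsilon> (r - dist x\<^sub>0 y - t)"
    using assms(2) unfolding closure_approachable by blast
  have C\<Omega>: "C \<subseteq> \<Omega>" using assms(1) by (rule in_components_subset)
  have in_ball: "p + s *\<^sub>R h \<in> ball x\<^sub>0 r" if "0 \<le> s" "s \<le> t" for s
  proof -
    have "dist x\<^sub>0 (p + s *\<^sub>R h) \<le> dist x\<^sub>0 y + dist y p + dist p (p + s *\<^sub>R h)"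
      by (meson add_mono dist_triangle dist_triangle_le order_refl order_trans)
    also have "dist p (p + s *\<^sub>R h) = s" using that h(2) by (simp add: dist_norm)
    finally show ?thesis using p(2) that by (simp add: dist_commute)
  qed
  have "closed_segment p (p + t *\<^sub>R h) \<subseteq> \<Omega>"
  proof
    fix z assume "z \<in> closed_segment p (p + t *\<^sub>R h)"
    then obtain v where v: "0 \<le> v" "v \<le> 1" "z = (1 - v) *\<^sub>R p + v *\<^sub>R (p + t *\<^sub>R h)"
      unfolding closed_segment_def by auto
    then have z: "z = p + (v * t) *\<^sub>R h" by (simp add: algebra_simps)
    show "z \<in> \<Omega>"
    \<comment> \<open>The cone inequality is strict and fails at the apex, so \<open>p\<close>
      itself is treated separately.\<close>
    proof (cases "v = 0")
      case True
      then show ?thesis using z p(1) C\<Omega> by auto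
    next
      case False
      have vt: "0 < v * t" "v * t \<le> t" using v t(1) False by (auto simp: mult_le_cancel_right1)
      have "\<eta> * norm (z - p) = (v * t) * (\<eta> * norm h)" using vt(1) z by (simp add: abs_of_pos)
      also have "\<dots> < (v * t) * (h \<bullet> e)" using h(1) vt(1) by (rule mult_strict_left_mono)
      also have "\<dots> = (z - p) \<bullet> e" using z by simp
      finally show ?thesis
        using cone[of p z] p(1) C\<Omega> in_ball[of 0] in_ball[of "v * t"] vt z t(1) by auto
    qed
  qed
  then have "closed_segment p (p + t *\<^sub>R h) \<subseteq> C"
    using components_maximal[OF assms(1) connected_segment(1)] p(1) by auto
  then have "p + t *\<^sub>R h \<in> C" by auto
  then show "\<exists>z\<in>C. dist z (y + t *\<^sub>R h) < \<epsilon>"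
    using p(2) by (intro bexI[of _ "p + t *\<^sub>R h"]) (auto simp: dist_norm)
qed

text \<open>Puts a gradient into the form of the difference quotient in
  \<open>has_normal_derivative\<close>, so that the barrier can be added to \<open>f\<close> in that
  quotient.\<close>

lemma GDERIV_one_sided:
  assumes "GDERIV g y :> G"
  shows "((\<lambda>t. (g y - g (y - t *\<^sub>R \<mu>)) / t) \<longlongrightarrow> \<mu> \<bullet> G) (at_right 0)"
proof -
  have "((\<lambda>t. y - t *\<^sub>R \<mu>) has_derivative (\<lambda>t. - (t *\<^sub>R \<mu>))) (at 0)"
    by (auto intro!: derivative_eq_intros)
  from has_derivative_compose[OF this, of g "\<lambda>h. h \<bullet> G"]
  have "((\<lambda>t. g (y - t *\<^sub>R \<mu>)) has_derivative (\<lambda>t. - (t *\<^sub>R \<mu>) \<bullet> G)) (at 0)"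
    using assms by (simp add: gderiv_def)
  moreover have "(\<lambda>t. - (t *\<^sub>R \<mu>) \<bullet> G) = (*) (- (\<mu> \<bullet> G))"
    by (simp add: fun_eq_iff mult.commute)
  ultimately have "((\<lambda>t. g (y - t *\<^sub>R \<mu>)) has_real_derivative - (\<mu> \<bullet> G)) (at 0)"
    by (simp add: has_field_derivative_def)
  then have "((\<lambda>t. (g (y - t *\<^sub>R \<mu>) - g y) / t) \<longlongrightarrow> - (\<mu> \<bullet> G)) (at 0)"
    by (simp add: DERIV_def)
  from tendsto_minus[OF this]
  have "((\<lambda>t. (g y - g (y - t *\<^sub>R \<mu>)) / t) \<longlongrightarrow> \<mu> \<bullet> G) (at 0)"
    by (simp add: minus_divide_left)
  then show ?thesis by (rule tendsto_within_subset) simp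
qed

text \<open>A substitute for Hopf's boundary point lemma, which fails at single points of \<open>C\<^sup>1\<close>
  domains: here the normal derivative vanishes at every boundary point near \<open>x\<^sub>0\<close>.\<close>

lemma harmonic_boundary_maximum:
  fixes f :: "'a::euclidean_space \<Rightarrow> real"
  assumes "open \<Omega>" "bounded \<Omega>" "C \<in> components \<Omega>" "harmonic_on f \<Omega>"
    and cont: "continuous_on (closure \<Omega>) f"
    and bc: "\<And>y. y \<in> frontier \<Omega> \<Longrightarrow>
      f y \<le> q \<or> (\<exists>\<mu>. outward_unit_normal \<Omega> y \<mu> \<and> has_normal_derivative f \<mu> y 0)"
    and le: "\<And>x. x \<in> closure C \<Longrightarrow> f x \<le> M" and lt: "\<And>x. x \<in> C \<Longrightarrow> f x < M"
    and "q < M" and x0: "x\<^sub>0 \<in> frontier C"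
  shows "f x\<^sub>0 < M"
proof (rule ccontr)
  assume "\<not> f x\<^sub>0 < M"
  have C\<Omega>: "C \<subseteq> \<Omega>" using assms(3) by (rule in_components_subset)
  have Copen: "open C" using assms(1,3) by (rule open_components)
  have cl: "closure C \<subseteq> closure \<Omega>" using C\<Omega> by (rule closure_mono)
  have fr: "frontier C \<subseteq> frontier \<Omega>" using assms(3) by (rule frontier_of_components_subset)
  have closure_C: "y \<in> frontier \<Omega>" "y \<notin> \<Omega>" if "y \<in> closure C" "y \<notin> C" for y
  proof -
    have "y \<in> frontier C" using that Copen by (simp add: frontier_def interior_open)
    then show "y \<in> frontier \<Omega>" using fr by blast
    then show "y \<notin> \<Omega>" using assms(1) by (simp add: frontier_def interior_open)
  qed
  have x0c: "x\<^sub>0 \<in> closure C" using x0 by (simp add: frontier_def)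
  have fx0: "f x\<^sub>0 = M" using \<open>\<not> f x\<^sub>0 < M\<close> le[OF x0c] by simp
  define N where "N = real DIM('a)"
  have N: "N \<ge> 1" using DIM_positive[where 'a='a] unfolding N_def by linarith
  \<comment> \<open>At boundary points within distance \<open>\<rho>\<close> of
    \<open>x\<^sub>0\<close> the component \<open>t\<close> along \<open>e\<close> will satisfy
    \<open>\<bar>t\<bar> \<le> \<eta> * \<rho>\<close>; then \<open>(N + 1) * t\<close> is at most
    \<open>\<rho> / 8\<close> in absolute value.\<close>
  define \<eta> where "\<eta> = 1 / (8 * (N + 1))"
  have \<eta>: "\<eta> > 0" "(N + 1) * \<eta> = 1/8" "\<eta> \<le> 1/16" using N by (auto simp: \<eta>_def field_simps)
  obtain \<nu> where \<nu>: "outward_unit_normal \<Omega> x\<^sub>0 \<nu>"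
    using bc[of x\<^sub>0] fr x0 fx0 \<open>q < M\<close> by force
  define e where "e = - \<nu>"
  have e: "norm e = 1" using \<nu> outward_unit_normal_norm by (simp add: e_def)
  have ee: "e \<bullet> e = 1" using e by (simp add: norm_eq_1)
  obtain r where r: "r > 0"
    and cone\<nu>: "\<forall>p\<in>closure \<Omega> \<inter> ball x\<^sub>0 r. \<forall>y\<in>ball x\<^sub>0 r.
      (y - p) \<bullet> \<nu> < - \<eta> * norm (y - p) \<longrightarrow> y \<in> \<Omega>"
    using outward_unit_normal_interior_cone[OF \<nu> assms(1) \<eta>(1)] by auto
  have cone: "y \<in> \<Omega>" if "p \<in> closure \<Omega>" "p \<in> ball x\<^sub>0 r" "y \<in> ball x\<^sub>0 r"
    "\<eta> * norm (y - p) < (y - p) \<bullet> e" for p y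
    using cone\<nu> that by (simp add: e_def)
  \<comment> \<open>By continuity the first alternative of \<open>bc\<close> is excluded near
    \<open>x\<^sub>0\<close>, so the normal derivative vanishes at all boundary points
    there.\<close>
  have "eventually (\<lambda>y. q < f y) (at x\<^sub>0 within closure \<Omega>)"
    using cont x0c cl \<open>q < M\<close> fx0 by (auto simp: continuous_on_def intro: order_tendstoD)
  then obtain s where s: "s > 0" "\<And>y. y \<in> closure \<Omega> \<Longrightarrow> dist y x\<^sub>0 < s \<Longrightarrow> q < f y"
    unfolding eventually_at using fx0 \<open>q < M\<close> by metis
  define \<rho> where "\<rho> = min r s / 2"
  have \<rho>: "\<rho> > 0" "\<rho> < r" "\<rho> < s" using r s(1) by (auto simp: \<rho>_def min_def)
  have x0\<Omega>: "x\<^sub>0 \<in> closure \<Omega>" "x\<^sub>0 \<notin> \<Omega>"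
    using x0 fr assms(1) by (auto simp: frontier_def interior_open)
  \<comment> \<open>Otherwise \<open>x\<^sub>0\<close> would lie in the cone with apex
    \<open>y\<close> and hence in \<open>\<Omega>\<close>. Together with \<open>lower\<close>, this
    makes the boundary nearly flat around \<open>x\<^sub>0\<close>.\<close>
  have upper: "- \<eta> * norm (y - x\<^sub>0) \<le> (y - x\<^sub>0) \<bullet> e" if "y \<in> closure \<Omega>" "y \<in> ball x\<^sub>0 r" for y
  proof (rule ccontr)
    assume "\<not> ?thesis"
    then have "\<eta> * norm (x\<^sub>0 - y) < (x\<^sub>0 - y) \<bullet> e"
      by (simp add: norm_minus_commute inner_diff_left)
    then show False using cone[OF that, of x\<^sub>0] r x0\<Omega>(2) by auto
  qed
  have lower: "(y - x\<^sub>0) \<bullet> e \<le> \<eta> * norm (y - x\<^sub>0)" if "y \<notin> \<Omega>" "y \<in> ball x\<^sub>0 r" for y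
    using cone[OF x0\<Omega>(1) _ that(2)] that(1) r by force
  let ?g = "barrier x\<^sub>0 e \<rho>"
  \<comment> \<open>A nonnegative barrier on the sphere puts \<open>y\<close> into the cone with
    apex \<open>x\<^sub>0\<close>, hence into \<open>\<Omega>\<close> and so into \<open>C\<close>,
    where \<open>f\<close> is below \<open>M\<close>.\<close>
  have sphere_lt: "f y < M" if y: "y \<in> closure C" "dist x\<^sub>0 y = \<rho>" "0 \<le> ?g y" for y
  proof -
    define d where "d = y - x\<^sub>0"
    define t where "t = d \<bullet> e"
    have nd: "norm d = \<rho>" using y(2) by (simp add: d_def dist_norm norm_minus_commute)
    have ball: "y \<in> ball x\<^sub>0 r" using y(2) \<rho>(2) by simp
    have t1: "- \<eta> * \<rho> \<le> t" using upper[OF _ ball] y(1) cl nd unfolding t_def d_def by auto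
    have g: "\<rho>\<^sup>2 \<le> \<rho> * t + (N + 1) * t\<^sup>2"
      using y(3) nd by (simp add: barrier_def N_def flip: d_def t_def power2_norm_eq_inner)
    have "\<eta> * \<rho> < t"
    proof (rule ccontr)
      assume "\<not> \<eta> * \<rho> < t"
      then have "\<bar>t\<bar> \<le> \<eta> * \<rho>" using t1 by simp
      then have "t\<^sup>2 \<le> (\<eta> * \<rho>)\<^sup>2" by (metis abs_ge_zero power2_abs power_mono)
      then have "(N + 1) * t\<^sup>2 \<le> (N + 1) * (\<eta> * \<rho>)\<^sup>2" using N by (intro mult_left_mono) auto
      also have "\<dots> = ((N + 1) * \<eta>) * \<eta> * \<rho>\<^sup>2" by (simp add: power2_eq_square)
      also have "\<dots> = \<eta> / 8 * \<rho>\<^sup>2" using \<eta>(2) by simp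
      finally have "(N + 1) * t\<^sup>2 \<le> \<eta> / 8 * \<rho>\<^sup>2" .
      moreover have "\<rho> * t \<le> \<eta> * \<rho>\<^sup>2"
        using \<open>\<not> \<eta> * \<rho> < t\<close> \<rho>(1) mult_left_mono[of t "\<eta> * \<rho>" \<rho>]
        by (simp add: power2_eq_square mult_ac)
      ultimately have "\<rho>\<^sup>2 \<le> (\<eta> + \<eta> / 8) * \<rho>\<^sup>2" using g by (simp add: algebra_simps)
      then show False using \<rho>(1) \<eta>(3) by (simp add: mult_le_cancel_right1)
    qed
    then have "\<eta> * norm (y - x\<^sub>0) < (y - x\<^sub>0) \<bullet> e" using nd by (simp add: t_def d_def)
    then have "y \<in> \<Omega>" using cone[OF x0\<Omega>(1) _ ball] r by simp
    then have "y \<in> C" using closure_C(2)[OF y(1)] by blast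
    then show ?thesis by (rule lt)
  qed
  have comp: "compact (closure C)"
    using assms(2) C\<Omega> bounded_subset by (auto simp: compact_closure)
  define K where "K = closure C \<inter> cball x\<^sub>0 \<rho>"
  have K: "compact K" "continuous_on K f" "x\<^sub>0 \<in> K"
    using comp cont cl x0c \<rho>(1) unfolding K_def
    by (auto intro: compact_Int_closed continuous_on_subset)
  have "compact (K \<inter> sphere x\<^sub>0 \<rho>)" using K(1) by (intro compact_Int_closed) auto
  moreover have "continuous_on (K \<inter> sphere x\<^sub>0 \<rho>) f" using K(2) continuous_on_subset by blast
  ultimately have "\<exists>\<epsilon>>0. \<forall>y\<in>K \<inter> sphere x\<^sub>0 \<rho>. f y + \<epsilon> * ?g y < M"
    by (rule compact_small_perturbation)
      (auto intro: le sphere_lt continuous_on_barrier simp: K_def)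
  then obtain \<epsilon> where \<epsilon>: "\<epsilon> > 0" "\<And>y. y \<in> K \<Longrightarrow> dist x\<^sub>0 y = \<rho> \<Longrightarrow> f y + \<epsilon> * ?g y < M"
    by auto
  have "continuous_on K (\<lambda>y. f y + \<epsilon> * ?g y)"
    by (intro continuous_intros continuous_on_barrier K)
  then obtain y where y: "y \<in> K" "\<And>z. z \<in> K \<Longrightarrow> f z + \<epsilon> * ?g z \<le> f y + \<epsilon> * ?g y"
    using continuous_attains_sup[OF K(1)] K(3) by blast
  have "M \<le> f y + \<epsilon> * ?g y" using y(2)[OF K(3)] fx0 by simp
  then have yr: "dist x\<^sub>0 y < \<rho>" using \<epsilon>(2)[OF y(1)] y(1) by (force simp: K_def)
  have yc: "y \<in> closure C" using y(1) by (simp add: K_def)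
  show False
  proof (cases "y \<in> C")
    case True
    have "harmonic_on f (C \<inter> ball x\<^sub>0 \<rho>)" using harmonic_on_subset[OF assms(4)] C\<Omega> by blast
    moreover have "open (C \<inter> ball x\<^sub>0 \<rho>)" "y \<in> C \<inter> ball x\<^sub>0 \<rho>" using True yr Copen by auto
    ultimately obtain z where "z \<in> C \<inter> ball x\<^sub>0 \<rho>" "f y + \<epsilon> * ?g y < f z + \<epsilon> * ?g z"
      using harmonic_add_barrier_no_max[OF _ _ _ e \<epsilon>(1)] by blast
    then show False using y(2)[of z] closure_subset[of C] by (auto simp: K_def)
  next
    case False
    then have yf: "y \<in> frontier \<Omega>" and y\<Omega>: "y \<in> closure \<Omega>" "y \<notin> \<Omega>"
      using closure_C[OF yc] yc cl by auto
    have yb: "y \<in> ball x\<^sub>0 r" using yr \<rho>(2) by simp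
    have "q < f y" using s(2)[OF y\<Omega>(1)] yr \<rho>(3) by (simp add: dist_commute)
    then obtain \<mu> where \<mu>: "outward_unit_normal \<Omega> y \<mu>" "has_normal_derivative f \<mu> y 0"
      using bc[OF yf] by auto
    define d where "d = y - x\<^sub>0"
    define t where "t = d \<bullet> e"
    have nd: "norm d \<le> \<rho>" using yr by (simp add: d_def dist_norm norm_minus_commute)
    have nd': "\<eta> * norm d \<le> \<eta> * \<rho>" using nd \<eta>(1) by simp
    have t: "\<bar>t\<bar> \<le> \<eta> * \<rho>"
      using upper[OF y\<Omega>(1) yb] lower[OF y\<Omega>(2) yb] nd' by (simp add: t_def d_def)
    note dual = inner_normal_in_dual_cone[OF \<mu>(1) assms(1) r \<eta>(1) cone yb e]
    let ?G = "barrier_grad x\<^sub>0 e \<rho> y"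
    have Nt: "\<bar>(N + 1) * t\<bar> \<le> \<rho> / 8"
    proof -
      have "\<bar>(N + 1) * t\<bar> = (N + 1) * \<bar>t\<bar>" using N by (simp add: abs_mult)
      also have "\<dots> \<le> (N + 1) * (\<eta> * \<rho>)" using t N by (intro mult_left_mono) auto
      also have "\<dots> = \<rho> / 8" using \<eta>(2) by simp
      finally show ?thesis .
    qed
    have G: "?G = (\<rho> + 2 * ((N + 1) * t)) *\<^sub>R e - 2 *\<^sub>R d"
      by (simp add: barrier_grad_def N_def t_def d_def mult.assoc)
    have nG: "norm ?G \<le> 4 * \<rho>"
    proof -
      have "norm ?G \<le> norm ((\<rho> + 2 * ((N + 1) * t)) *\<^sub>R e) + norm (2 *\<^sub>R d)"
        unfolding G by (rule norm_triangle_ineq4)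
      also have "\<dots> = \<bar>\<rho> + 2 * ((N + 1) * t)\<bar> + 2 * norm d" using e by simp
      finally show ?thesis using Nt nd by linarith
    qed
    have "\<eta> * \<rho> \<le> \<rho> / 16" using \<eta>(3) \<rho>(1) mult_right_mono[of \<eta> "1/16" \<rho>] by simp
    then have "t \<le> \<rho> / 16" using t by linarith
    have "\<eta> * norm ?G \<le> \<eta> * (4 * \<rho>)" using nG \<eta>(1) by (intro mult_left_mono) auto
    also have "\<dots> < \<rho> + 2 * ((N + 1) * t) - 2 * t"
      using Nt \<rho>(1) \<open>\<eta> * \<rho> \<le> \<rho> / 16\<close> \<open>t \<le> \<rho> / 16\<close> by linarith
    also have "\<dots> = ?G \<bullet> e" unfolding G using ee by (simp add: inner_diff_left t_def)
    \<comment> \<open>The barrier gradient lies in the cone around \<open>e\<close>, so the barrier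
      increases along the inner normal at \<open>y\<close>.\<close>
    finally have G\<mu>: "?G \<bullet> \<mu> < 0" by (rule dual[rotated -1])
    have nm: "norm (- \<mu>) = 1" using outward_unit_normal_norm[OF \<mu>(1)] by simp
    \<comment> \<open>If not, \<open>\<mu> \<bullet> e\<close> is at least \<open>- \<eta>\<close>.
      But \<open>e + \<eta> *\<^sub>R \<mu>\<close> is a cone direction, so its product with
      \<open>\<mu>\<close>, which is \<open>e \<bullet> \<mu> + \<eta>\<close>, would be
      negative.\<close>
    have inward: "\<eta> * norm (- \<mu>) < (- \<mu>) \<bullet> e"
    proof (rule ccontr)
      assume "\<not> ?thesis"
      then have *: "- (\<mu> \<bullet> e) \<le> \<eta>" using nm by simp
      have "\<eta> * norm (e + \<eta> *\<^sub>R \<mu>) \<le> \<eta> * (1 + \<eta>)"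
        using norm_triangle_ineq[of e "\<eta> *\<^sub>R \<mu>"] e nm \<eta>(1) by (intro mult_left_mono) auto
      also have "\<dots> < 1 - \<eta> * \<eta>"
      proof -
        have "\<eta> * \<eta> \<le> 1/16 * (1/16)" using \<eta> by (intro mult_mono) auto
        then show ?thesis using \<eta>(3) by (simp add: algebra_simps)
      qed
      also have "\<dots> \<le> (e + \<eta> *\<^sub>R \<mu>) \<bullet> e"
        using mult_left_mono[OF *, of \<eta>] \<eta>(1) ee by (simp add: inner_add_left)
      finally have "(e + \<eta> *\<^sub>R \<mu>) \<bullet> \<mu> < 0" by (rule dual[rotated -1])
      moreover have "\<mu> \<bullet> \<mu> = 1" using nm by (simp add: norm_eq_1)
      ultimately show False using * by (simp add: inner_add_left inner_commute[of e \<mu>])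
    qed
    have inC: "y - \<tau> *\<^sub>R \<mu> \<in> K" if "0 < \<tau>" "\<tau> < \<rho> - dist x\<^sub>0 y" for \<tau>
    proof -
      have "y + \<tau> *\<^sub>R (- \<mu>) \<in> closure C"
        using that \<rho>(2) closure_subset[of \<Omega>]
        by (intro inward_segment_in_component[OF assms(3) yc yb cone inward nm]) auto
      moreover have "dist x\<^sub>0 (y - \<tau> *\<^sub>R \<mu>) \<le> dist x\<^sub>0 y + \<tau>"
        using dist_triangle[of x\<^sub>0 "y - \<tau> *\<^sub>R \<mu>" y] nm that(1) by (simp add: dist_norm)
      ultimately show ?thesis using that by (simp add: K_def)
    qed
    let ?q = "\<lambda>v \<tau>. (v y - v (y - \<tau> *\<^sub>R \<mu>)) / \<tau> :: real"
    \<comment> \<open>The limit is negative by \<open>G\<mu>\<close>, whereas maximality of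
      \<open>y\<close> on \<open>K\<close> makes all quotients for small \<open>\<tau>\<close>
      nonnegative.\<close>
    have "((\<lambda>\<tau>. ?q f \<tau> + \<epsilon> * ?q ?g \<tau>) \<longlongrightarrow> 0 + \<epsilon> * (\<mu> \<bullet> ?G)) (at_right 0)"
      using \<mu>(2) unfolding has_normal_derivative_def
      by (intro tendsto_intros GDERIV_one_sided GDERIV_barrier)
    moreover have "eventually (\<lambda>\<tau>. 0 \<le> ?q f \<tau> + \<epsilon> * ?q ?g \<tau>) (at_right 0)"
    proof -
      have "eventually (\<lambda>\<tau>. 0 < \<tau> \<and> \<tau> < \<rho> - dist x\<^sub>0 y) (at_right (0::real))"
        using eventually_at_right_real[of 0 "\<rho> - dist x\<^sub>0 y"] yr by simp
      then show ?thesis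
      proof eventually_elim
        case (elim \<tau>)
        have "?q f \<tau> + \<epsilon> * ?q ?g \<tau> =
          ((f y + \<epsilon> * ?g y) - (f (y - \<tau> *\<^sub>R \<mu>) + \<epsilon> * ?g (y - \<tau> *\<^sub>R \<mu>))) / \<tau>"
          by (simp add: diff_divide_distrib add_divide_distrib right_diff_distrib)
        then show ?case using y(2)[OF inC] elim by simp
      qed
    qed
    ultimately have "0 \<le> 0 + \<epsilon> * (\<mu> \<bullet> ?G)"
      by (rule tendsto_lowerbound) simp
    then show False using G\<mu> \<epsilon>(1) by (simp add: inner_commute zero_le_mult_iff)
  qed
qed

text \<open>Take a maximum point of \<open>f\<close> on \<open>closure C\<close>. If the value is
  also attained in \<open>C\<close>, the strong maximum principle makes \<open>f\<close> constant
  there; otherwise the point lies on the frontier and \<open>harmonic_boundary_maximum\<close>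
  bounds the value by \<open>q\<close>.\<close>

lemma harmonic_component_max_principle:
  fixes f :: "'a::euclidean_space \<Rightarrow> real"
  assumes "open \<Omega>" "bounded \<Omega>" "C \<in> components \<Omega>" "harmonic_on f \<Omega>"
    and cont: "continuous_on (closure \<Omega>) f"
    and bc: "\<And>y. y \<in> frontier \<Omega> \<Longrightarrow>
      f y \<le> q \<or> (\<exists>\<mu>. outward_unit_normal \<Omega> y \<mu> \<and> has_normal_derivative f \<mu> y 0)"
  shows "(\<forall>x\<in>C. f x \<le> q) \<or> (\<exists>k. \<forall>x\<in>C. f x = k)"
proof -
  have C\<Omega>: "C \<subseteq> \<Omega>" using assms(3) by (rule in_components_subset)
  have Copen: "open C" using assms(1,3) by (rule open_components)
  have "compact (closure C)"
    using assms(2) C\<Omega> bounded_subset by (auto simp: compact_closure)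
  moreover have "closure C \<noteq> {}" using in_components_nonempty[OF assms(3)] by simp
  moreover have "continuous_on (closure C) f"
    using continuous_on_subset[OF cont closure_mono[OF C\<Omega>]] .
  ultimately obtain x0 where x0: "x0 \<in> closure C" "\<And>x. x \<in> closure C \<Longrightarrow> f x \<le> f x0"
    using continuous_attains_sup[of "closure C" f] by blast
  have le: "f x \<le> f x0" if "x \<in> C" for x using x0(2) closure_subset that by blast
  show ?thesis
  proof (cases "\<exists>z\<in>C. f z = f x0")
    case True
    then obtain z where z: "z \<in> C" "f z = f x0" by blast
    have "f x = f x0" if "x \<in> C" for x
      using harmonic_strong_max_principle[OF harmonic_on_subset[OF assms(4) C\<Omega>] Copen
          in_components_connected[OF assms(3)] le z that] .
    then show ?thesis by blast
  next
    case False
    then have lt: "f x < f x0" if "x \<in> C" for x using le[OF that] that by force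
    have "x0 \<in> frontier C" using x0(1) Copen False by (auto simp: frontier_def interior_open)
    then have "\<not> q < f x0"
      using harmonic_boundary_maximum[OF assms(1-4) cont bc x0(2) lt] by blast
    then show ?thesis using le by force
  qed
qed

section \<open>Truncation\<close>

text \<open>Clamping confines the values to \<open>{0..1}\<close> at every point of the space, also
  outside \<open>closure \<Omega>\<close>, as the composition lemmas demand.\<close>

definition clamp01 :: "real \<Rightarrow> real" where "clamp01 s = max 0 (min 1 s)"

lemma clamp01_mem: "clamp01 s \<in> {0..1}"
  by (simp add: clamp01_def)

text \<open>The quotient of the composition is dominated by \<open>L\<close> times a quotient
  tending to 0. This handles \<open>clamp01\<close> at its kinks, where no chain rule
  applies.\<close>

lemma has_normal_derivative_lipschitz_comp:
  assumes "has_normal_derivative v \<nu> x 0" and "\<And>y. v y \<in> T"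
    and lip: "\<And>s t. s \<in> T \<Longrightarrow> t \<in> T \<Longrightarrow> \<bar>F s - F t\<bar> \<le> L * \<bar>s - t\<bar>"
  shows "has_normal_derivative (\<lambda>y. F (v y)) \<nu> x 0"
  unfolding has_normal_derivative_def
proof (rule Lim_null_comparison)
  have "((\<lambda>t. L * \<bar>(v x - v (x - t *\<^sub>R \<nu>)) / t\<bar>) \<longlongrightarrow> L * \<bar>0\<bar>) (at_right 0)"
    using assms(1) unfolding has_normal_derivative_def by (intro tendsto_intros)
  then show "((\<lambda>t. L * \<bar>(v x - v (x - t *\<^sub>R \<nu>)) / t\<bar>) \<longlongrightarrow> 0) (at_right 0)" by simp
  have "norm ((F (v x) - F (v (x - t *\<^sub>R \<nu>))) / t) \<le> L * \<bar>(v x - v (x - t *\<^sub>R \<nu>)) / t\<bar>" for t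
    using divide_right_mono[OF lip[OF assms(2) assms(2), of x "x - t *\<^sub>R \<nu>"], of "\<bar>t\<bar>"]
    by (simp add: abs_divide)
  then show "\<forall>\<^sub>F t in at_right 0. norm ((F (v x) - F (v (x - t *\<^sub>R \<nu>))) / t)
      \<le> L * \<bar>(v x - v (x - t *\<^sub>R \<nu>)) / t\<bar>" by simp
qed

lemma mixed_bc_lipschitz_comp:
  assumes "mixed_bc \<Gamma>\<^sub>1 \<Gamma>\<^sub>2 \<Gamma>\<^sub>3 n p q v" "\<And>y. v y \<in> T"
    "\<And>s t. s \<in> T \<Longrightarrow> t \<in> T \<Longrightarrow> \<bar>F s - F t\<bar> \<le> L * \<bar>s - t\<bar>"
  shows "mixed_bc \<Gamma>\<^sub>1 \<Gamma>\<^sub>2 \<Gamma>\<^sub>3 n (F p) (F q) (\<lambda>x. F (v x))"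
  using assms(1) unfolding mixed_bc_def
  by (simp add: has_normal_derivative_lipschitz_comp[where v = v, OF _ assms(2,3)])

lemma mixed_laplace_solution_clamp01:
  fixes \<Omega> \<Gamma>\<^sub>1 \<Gamma>\<^sub>2 \<Gamma>\<^sub>3 :: "'a::euclidean_space set"
  assumes "open \<Omega>" "bounded \<Omega>" and fr: "\<Gamma>\<^sub>1 \<union> \<Gamma>\<^sub>2 \<union> \<Gamma>\<^sub>3 = frontier \<Omega>"
    and n: "\<And>x. x \<in> \<Gamma>\<^sub>3 \<Longrightarrow> outward_unit_normal \<Omega> x (n x)"
    and z: "mixed_laplace_solution \<Omega> \<Gamma>\<^sub>1 \<Gamma>\<^sub>2 \<Gamma>\<^sub>3 n z"
  shows "mixed_laplace_solution \<Omega> \<Gamma>\<^sub>1 \<Gamma>\<^sub>2 \<Gamma>\<^sub>3 n (\<lambda>x. clamp01 (z x))"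
proof -
  have cont: "continuous_on (closure \<Omega>) z" and harm: "harmonic_on z \<Omega>"
    and bc: "mixed_bc \<Gamma>\<^sub>1 \<Gamma>\<^sub>2 \<Gamma>\<^sub>3 n 0 1 z"
    using z unfolding mixed_laplace_solution_def harmonic_on_def by auto
  have upper: "(\<forall>x\<in>C. z x \<le> 1) \<or> (\<exists>k. \<forall>x\<in>C. z x = k)" if "C \<in> components \<Omega>" for C
  proof (rule harmonic_component_max_principle[OF assms(1,2) that harm cont])
    fix y assume "y \<in> frontier \<Omega>"
    then consider "y \<in> \<Gamma>\<^sub>1" | "y \<in> \<Gamma>\<^sub>2" | "y \<in> \<Gamma>\<^sub>3" using fr by blast
    then show "z y \<le> 1 \<or> (\<exists>\<mu>. outward_unit_normal \<Omega> y \<mu> \<and> has_normal_derivative z \<mu> y 0)"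
      using bc n unfolding mixed_bc_def by cases auto
  qed
  have neg: "has_normal_derivative (\<lambda>x. (- 1) * z x) \<mu> y 0" if "has_normal_derivative z \<mu> y 0" for \<mu> y
    by (rule has_normal_derivative_lipschitz_comp[OF that, of UNIV _ 1]) (auto simp: abs_minus_commute)
  \<comment> \<open>The lower bound is the upper bound for the negative of \<open>z\<close>, with
    boundary level \<open>q = 0\<close>.\<close>
  have lower: "(\<forall>x\<in>C. (- 1) * z x \<le> 0) \<or> (\<exists>k. \<forall>x\<in>C. (- 1) * z x = k)"
    if "C \<in> components \<Omega>" for C
  proof (rule harmonic_component_max_principle[OF assms(1,2) that harmonic_on_scaleR[OF harm assms(1)]])
    show "continuous_on (closure \<Omega>) (\<lambda>x. (- 1) * z x)" using cont by (intro continuous_intros)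
    fix y assume "y \<in> frontier \<Omega>"
    then consider "y \<in> \<Gamma>\<^sub>1" | "y \<in> \<Gamma>\<^sub>2" | "y \<in> \<Gamma>\<^sub>3" using fr by blast
    then show "(- 1) * z y \<le> 0 \<or>
        (\<exists>\<mu>. outward_unit_normal \<Omega> y \<mu> \<and> has_normal_derivative (\<lambda>x. (- 1) * z x) \<mu> y 0)"
    proof cases
      case 3
      then show ?thesis using bc n[OF 3] neg[of "n y" y] unfolding mixed_bc_def by blast
    qed (use bc in \<open>auto simp: mixed_bc_def\<close>)
  qed
  have "harmonic_on (\<lambda>x. clamp01 (z x)) \<Omega>"
  proof (rule harmonic_on_open_cover)
    fix x assume x: "x \<in> \<Omega>"
    let ?C = "connected_component_set \<Omega> x"
    have C: "?C \<in> components \<Omega>" using x by (rule componentsI)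
    have sub: "?C \<subseteq> \<Omega>" and op: "open ?C"
      using in_components_subset[OF C] open_components[OF assms(1) C] .
    have "harmonic_on (\<lambda>x. clamp01 (z x)) ?C"
    proof (cases "\<exists>k. \<forall>y\<in>?C. z y = k")
      case True
      then obtain k where "\<And>y. y \<in> ?C \<Longrightarrow> z y = k" by blast
      then show ?thesis
        by (intro harmonic_on_cong[OF harmonic_on_const[of "clamp01 k"] op]) simp
    next
      case False
      then have "\<forall>y\<in>?C. z y \<le> 1" using upper[OF C] by blast
      moreover have "\<forall>y\<in>?C. (- 1) * z y \<le> 0"
      proof (rule ccontr)
        assume "\<not> ?thesis"
        then obtain k where k: "\<forall>y\<in>?C. (- 1) * z y = k" using lower[OF C] by blast
        have "z y = - k" if "y \<in> ?C" for y using bspec[OF k that] by simp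
        then show False using False by blast
      qed
      ultimately have "z y \<in> {0..1}" if "y \<in> ?C" for y using that by simp
      then show ?thesis
        by (intro harmonic_on_cong[OF harmonic_on_subset[OF harm sub] op])
          (simp add: clamp01_def min_absorb2 max_absorb2)
    qed
    moreover have "x \<in> ?C" using x by simp
    ultimately show "\<exists>T. open T \<and> x \<in> T \<and> T \<subseteq> \<Omega> \<and> harmonic_on (\<lambda>x. clamp01 (z x)) T"
      using sub op by blast
  qed
  moreover have "continuous_on (closure \<Omega>) (\<lambda>x. clamp01 (z x))"
    unfolding clamp01_def using cont by (intro continuous_intros)
  moreover have "mixed_bc \<Gamma>\<^sub>1 \<Gamma>\<^sub>2 \<Gamma>\<^sub>3 n (clamp01 0) (clamp01 1) (\<lambda>x. clamp01 (z x))"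
    by (rule mixed_bc_lipschitz_comp[OF bc, of UNIV _ 1]) (auto simp: clamp01_def)
  ultimately show ?thesis
    unfolding mixed_laplace_solution_def harmonic_on_def by (simp add: clamp01_def)
qed

section \<open>The ordinary differential equation\<close>

text \<open>If \<open>f t < l\<close>, let \<open>s\<close> be the last point before
  \<open>t\<close> with \<open>f s \<ge> l\<close>. The intermediate value theorem gives
  \<open>f s = l\<close>, and the positive derivative there pushes \<open>f\<close> above
  \<open>l\<close> right after \<open>s\<close>.\<close>

lemma real_level_not_crossed_downward:
  fixes f :: "real \<Rightarrow> real"
  assumes cont: "continuous_on {p..q} f"
    and d: "\<And>t. t \<in> {p..q} \<Longrightarrow> f t = l \<Longrightarrow> \<exists>D>0. (f has_real_derivative D) (at t within {p..q})"
    and "l \<le> f p" and t: "t \<in> {p..q}"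
  shows "l \<le> f t"
proof (rule ccontr)
  assume "\<not> l \<le> f t"
  define K where "K = {s \<in> {p..t}. l \<le> f s}"
  have c: "continuous_on {p..t} f" using continuous_on_subset[OF cont] t by simp
  have "closed ({p..t} \<inter> f -` {l..})"
    by (rule continuous_closed_preimage[OF c]) auto
  then have "compact ({p..t} \<inter> ({p..t} \<inter> f -` {l..}))"
    by (rule compact_Int_closed[OF compact_Icc])
  moreover have "{p..t} \<inter> ({p..t} \<inter> f -` {l..}) = K" by (auto simp: K_def)
  ultimately have "compact K" by simp
  moreover have "K \<noteq> {}" using assms(3) t by (force simp: K_def)
  ultimately obtain s where s: "s \<in> K" "\<And>r. r \<in> K \<Longrightarrow> r \<le> s"
    using compact_attains_sup[of K] by blast
  have st: "p \<le> s" "s < t" "l \<le> f s"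
    using s(1) \<open>\<not> l \<le> f t\<close> by (auto simp: K_def less_le)
  have after: "f r < l" if "s < r" "r \<le> t" for r
    using s(2)[of r] that st by (force simp: K_def)
  have "f s \<le> l"
  proof (rule ccontr)
    assume "\<not> f s \<le> l"
    then obtain r where "s \<le> r" "r \<le> t" "f r = l"
      using IVT2'[of f t l s] \<open>\<not> l \<le> f t\<close> st continuous_on_subset[OF c, of "{s..t}"] by auto
    then show False using after[of r] \<open>\<not> f s \<le> l\<close> by (cases "r = s") auto
  qed
  then have "f s = l" using st by simp
  then obtain D where D: "D > 0" "(f has_real_derivative D) (at s within {p..q})"
    using d[of s] st t by auto
  obtain \<delta> where \<delta>: "\<delta> > 0" "\<And>h. 0 < h \<Longrightarrow> s + h \<in> {p..q} \<Longrightarrow> h < \<delta> \<Longrightarrow> f s < f (s + h)"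
    using has_real_derivative_pos_inc_right[OF D(2,1)] by blast
  define h where "h = min (\<delta>/2) (t - s)"
  have "h > 0" "h < \<delta>" "s + h \<le> t" using \<delta>(1) st by (auto simp: h_def)
  then show False using \<delta>(2)[of h] after[of "s + h"] st t \<open>f s = l\<close> by auto
qed

text \<open>The reflection taking \<open>f\<close> to \<open>\<lambda>s. - f (- s)\<close> preserves
  the sign of derivatives and exchanges the two ends of the interval.\<close>

lemma real_level_not_crossed_backward:
  fixes f :: "real \<Rightarrow> real"
  assumes cont: "continuous_on {p..q} f"
    and d: "\<And>t. t \<in> {p..q} \<Longrightarrow> f t = l \<Longrightarrow> \<exists>D>0. (f has_real_derivative D) (at t within {p..q})"
    and "f q \<le> l" and t: "t \<in> {p..q}"
  shows "f t \<le> l"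
proof -
  have "- l \<le> (\<lambda>s. - f (- s)) (- t)"
  proof (rule real_level_not_crossed_downward[where f = "\<lambda>s. - f (- s)"
        and l = "- l" and p = "- q" and q = "- p" and t = "- t"])
    show "continuous_on {-q..-p} (\<lambda>s. - f (- s))"
      by (intro continuous_on_minus continuous_on_compose2[OF cont, of _ uminus] continuous_intros) auto
    show "- l \<le> - f (- (- q))" using assms(3) by simp
    show "- t \<in> {-q..-p}" using t by simp
    fix s assume s: "s \<in> {-q..-p}" "- f (- s) = - l"
    then obtain D where D: "D > 0" "(f has_real_derivative D) (at (- s) within {p..q})"
      using d[of "- s"] by auto
    then have "(f has_real_derivative D) (at (uminus s) within uminus ` {-q..-p})" by simp
    moreover have "(uminus has_real_derivative - 1) (at s within {-q..-p})"
      by (auto intro!: derivative_eq_intros)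
    ultimately have "(f \<circ> uminus has_real_derivative D * - 1) (at s within {-q..-p})"
      by (rule DERIV_image_chain)
    from DERIV_minus[OF this]
    have "((\<lambda>s. - f (- s)) has_real_derivative D) (at s within {-q..-p})"
      by (simp add: o_def)
    then show "\<exists>D>0. ((\<lambda>s. - f (- s)) has_real_derivative D) (at s within {-q..-p})"
      using D(1) by blast
  qed
  then show ?thesis by simp
qed

text \<open>The equation is posed for arbitrary real \<open>\<gamma>\<close> and \<open>b/a\<close> is only known to be positive on
  the rectangle, so that \<open>U\<close> stays in \<open>[u\<^sub>1, u\<^sub>2]\<close> has to be read off the end values.\<close>

lemma ode_solution_range:
  fixes U :: "real \<Rightarrow> real" and g :: "real \<Rightarrow> real \<Rightarrow> real"
  assumes U: "\<And>t. t \<in> {p..q} \<Longrightarrow> (U has_real_derivative \<gamma> * g (U t) t) (at t within {p..q})"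
    and g: "\<And>v t. v \<in> {u\<^sub>1..u\<^sub>2} \<Longrightarrow> t \<in> {p..q} \<Longrightarrow> 0 < g v t"
    and "u\<^sub>1 \<le> u\<^sub>2" "U p = u\<^sub>1" "U q = u\<^sub>2" and t: "t \<in> {p..q}"
  shows "U t \<in> {u\<^sub>1..u\<^sub>2}"
proof -
  have cont: "continuous_on {p..q} U"
    by (rule DERIV_continuous_on[OF U])
  consider "\<gamma> > 0" | "\<gamma> < 0" | "\<gamma> = 0" by linarith
  then show ?thesis
  proof cases
    case 1
    have d: "\<exists>D>0. (U has_real_derivative D) (at s within {p..q})"
      if "s \<in> {p..q}" "U s = l" "l \<in> {u\<^sub>1..u\<^sub>2}" for s l
      using U[OF that(1)] g[OF that(3,1)] that(2) 1 by (intro exI[of _ "\<gamma> * g (U s) s"]) auto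
    show ?thesis
      using real_level_not_crossed_downward[OF cont d[of _ u\<^sub>1] _ t]
        real_level_not_crossed_backward[OF cont d[of _ u\<^sub>2] _ t] assms(3-5) by simp
  next
    case 2
    have cont': "continuous_on {p..q} (\<lambda>s. - U s)" using cont by (intro continuous_intros)
    have d: "\<exists>D>0. ((\<lambda>s. - U s) has_real_derivative D) (at s within {p..q})"
      if "s \<in> {p..q}" "- U s = l" "- l \<in> {u\<^sub>1..u\<^sub>2}" for s l
      using DERIV_minus[OF U[OF that(1)]] g[OF that(3,1)] that(2) 2
      by (intro exI[of _ "- (\<gamma> * g (U s) s)"]) (auto simp: mult_neg_pos)
    \<comment> \<open>For negative \<open>\<gamma>\<close> the bounds come out reversed:
      \<open>U t\<close> lies between \<open>u\<^sub>2\<close> and \<open>u\<^sub>1\<close>, which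
      with \<open>u\<^sub>1 \<le> u\<^sub>2\<close> forces equality.\<close>
    have "- u\<^sub>1 \<le> - U t"
      by (rule real_level_not_crossed_downward[OF cont' _ _ t]) (use d assms(3,4) in auto)
    moreover have "- U t \<le> - u\<^sub>2"
      by (rule real_level_not_crossed_backward[OF cont' _ _ t]) (use d assms(3,5) in auto)
    ultimately show ?thesis using assms(3) by simp
  next
    case 3
    then obtain c where "\<forall>s\<in>{p..q}. U s = c"
      using has_field_derivative_zero_constant[of "{p..q}" U] U by auto
    then show ?thesis using assms(3-5) t by auto
  qed
qed

text \<open>\<open>K\<close> is the integral of \<open>\<beta>\<close>, and \<open>\<Psi>\<close> is
  the inverse of its antiderivative \<open>B\<close>, rescaled from \<open>{0..K}\<close> to
  \<open>{0..1}\<close>. Inverting difference quotients within closed intervals also yields the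
  one-sided derivatives at the ends.\<close>

lemma inverse_normalized_antiderivative:
  fixes \<beta> :: "real \<Rightarrow> real"
  assumes "p < q" and cont: "continuous_on {p..q} \<beta>" and pos: "\<And>t. t \<in> {p..q} \<Longrightarrow> 0 < \<beta> t"
  obtains K \<Psi> where "K > 0" "\<Psi> 0 = p" "\<Psi> 1 = q"
    "\<forall>s\<in>{0..1}. \<Psi> s \<in> {p..q} \<and> (\<Psi> has_real_derivative K / \<beta> (\<Psi> s)) (at s within {0..1})"
proof -
  define B where "B t = integral {p..t} \<beta>" for t
  have B: "(B has_real_derivative \<beta> t) (at t within {p..q})" if "t \<in> {p..q}" for t
    unfolding B_def using integral_has_real_derivative[OF cont that] .
  have Bc: "continuous_on {p..q} B"
    by (rule DERIV_continuous_on[OF B])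
  have mono: "B s < B t" if "p \<le> s" "s < t" "t \<le> q" for s t
  proof (rule DERIV_pos_imp_increasing_open[OF that(2)])
    show "continuous_on {s..t} B" using continuous_on_subset[OF Bc] that by auto
    fix x assume x: "s < x" "x < t"
    then have "(B has_real_derivative \<beta> x) (at x)"
      using B[of x] that by (simp add: at_within_Icc_at)
    then show "\<exists>y. (B has_real_derivative y) (at x) \<and> 0 < y" using pos[of x] x that by auto
  qed
  define K where "K = B q"
  have B0: "B p = 0" by (simp add: B_def)
  have K: "K > 0" using mono[of p q] assms(1) B0 by (simp add: K_def)
  have inj: "inj_on B {p..q}"
    by (rule inj_onI) (metis atLeastAtMost_iff less_irrefl linorder_neqE_linordered_idom mono)
  have img: "B ` {p..q} = {0..K}"
  proof
    show "B ` {p..q} \<subseteq> {0..K}"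
    proof
      fix v assume "v \<in> B ` {p..q}"
      then obtain t where t: "t \<in> {p..q}" "v = B t" by blast
      then have "B p \<le> B t" "B t \<le> B q" using mono[of p t] mono[of t q] by (auto simp: le_less)
      then show "v \<in> {0..K}" using t(2) B0 K_def by simp
    qed
    show "{0..K} \<subseteq> B ` {p..q}"
    proof
      fix v assume "v \<in> {0..K}"
      then show "v \<in> B ` {p..q}"
        using IVT'[of B p v q] Bc assms(1) B0 by (force simp: K_def)
    qed
  qed
  define J where "J = the_inv_into {p..q} B"
  define \<Psi> where "\<Psi> s = J (K * s)" for s
  have J: "J v \<in> {p..q}" "B (J v) = v" if "v \<in> {0..K}" for v
    using the_inv_into_into[OF inj, of v "{p..q}"] f_the_inv_into_f[OF inj, of v] that img
    by (simp_all add: J_def)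
  have JB: "J (B t) = t" if "t \<in> {p..q}" for t
    using inj that by (simp add: J_def the_inv_into_f_f)
  have Jc: "continuous_on {0..K} J"
    using continuous_on_inv_into[OF Bc _ inj] img by (simp add: J_def)
  have J': "(J has_real_derivative 1 / \<beta> (J v)) (at v within {0..K})" if v: "v \<in> {0..K}" for v
  proof -
    have lim: "((\<lambda>t. (B t - B (J v)) / (t - J v)) \<longlongrightarrow> \<beta> (J v)) (at (J v) within {p..q})"
      using B[OF J(1)[OF v]] by (simp add: has_field_derivative_iff)
    \<comment> \<open>\<open>J\<close> tends to \<open>J v\<close> without taking that value
      elsewhere, so \<open>J w\<close> may be substituted into the punctured limit
      \<open>lim\<close>.\<close>
    have "filterlim J (at (J v) within {p..q}) (at v within {0..K})"
    proof (rule filterlim_at_withinI)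
      show "filterlim J (nhds (J v)) (at v within {0..K})"
        using Jc v by (simp add: continuous_on_def)
      have "J w \<in> {p..q} - {J v}" if "w \<in> {0..K}" "w \<noteq> v" for w
        using J[OF that(1)] J(2)[OF v] that(2) by auto
      then show "\<forall>\<^sub>F w in at v within {0..K}. J w \<in> {p..q} - {J v}"
        unfolding eventually_at_filter by (simp add: eventually_mono)
    qed
    from filterlim_compose[OF lim this]
    have "((\<lambda>w. (B (J w) - B (J v)) / (J w - J v)) \<longlongrightarrow> \<beta> (J v)) (at v within {0..K})" .
    then have "((\<lambda>w. inverse ((B (J w) - B (J v)) / (J w - J v))) \<longlongrightarrow> inverse (\<beta> (J v))) (at v within {0..K})"
      using pos[OF J(1)[OF v]] by (intro tendsto_inverse) auto
    then have "((\<lambda>w. (J w - J v) / (w - v)) \<longlongrightarrow> inverse (\<beta> (J v))) (at v within {0..K})"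
    proof (rule Lim_transform_eventually)
      show "\<forall>\<^sub>F w in at v within {0..K}.
          inverse ((B (J w) - B (J v)) / (J w - J v)) = (J w - J v) / (w - v)"
        unfolding eventually_at_filter using J(2) v by (simp add: eventually_mono)
    qed
    then show ?thesis by (simp add: has_field_derivative_iff inverse_eq_divide)
  qed
  have Ks: "K * s \<in> {0..K}" if "s \<in> {0..1}" for s
    using that K by (simp add: mult_left_le)
  have Kimg: "(*) K ` {0..1} \<subseteq> {0..K}" using Ks by blast
  show thesis
  proof (rule that[OF K])
    show "\<Psi> 0 = p" using JB[of p] assms(1) B0 by (simp add: \<Psi>_def)
    show "\<Psi> 1 = q" using JB[of q] assms(1) by (simp add: \<Psi>_def K_def)
    show "\<forall>s\<in>{0..1}. \<Psi> s \<in> {p..q} \<and> (\<Psi> has_real_derivative K / \<beta> (\<Psi> s)) (at s within {0..1})"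
    proof
      fix s :: real assume s: "s \<in> {0..1}"
      have "((*) K has_real_derivative K) (at s within {0..1})"
        by (auto intro!: derivative_eq_intros)
      from DERIV_image_chain[OF DERIV_subset[OF J'[OF Ks[OF s]] Kimg] this]
      have "(\<Psi> has_real_derivative 1 / \<beta> (\<Psi> s) * K) (at s within {0..1})"
        by (simp add: \<Psi>_def[abs_def] o_def)
      then show "\<Psi> s \<in> {p..q} \<and> (\<Psi> has_real_derivative K / \<beta> (\<Psi> s)) (at s within {0..1})"
        using J(1)[OF Ks[OF s]] by (simp add: \<Psi>_def)
    qed
  qed
qed

section \<open>Composition\<close>

text \<open>\<open>F\<close> is differentiated only within \<open>T\<close>, one-sidedly at the ends
  of an interval; this suffices since every value of \<open>z\<close> lies in
  \<open>T\<close>.\<close>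

lemma GDERIV_comp_within:
  assumes z: "GDERIV z x :> G" and zT: "\<And>y. z y \<in> T"
    and F: "(F has_real_derivative D) (at (z x) within T)"
  shows "GDERIV (\<lambda>y. F (z y)) x :> D *\<^sub>R G"
proof -
  have "(F has_derivative (*) D) (at (z x) within range z)"
    using F zT unfolding has_field_derivative_def by (auto intro: has_derivative_subset)
  from has_derivative_in_compose[OF z[unfolded gderiv_def] this]
  show ?thesis by (simp add: gderiv_def)
qed

lemma C1_on_comp_within:
  fixes z :: "'a::euclidean_space \<Rightarrow> real"
  assumes "open \<Omega>" "C1_on z \<Omega>" "C1_on (grad z) \<Omega>" and zT: "\<And>y. z y \<in> T"
    and F: "\<And>s. s \<in> T \<Longrightarrow> (F has_real_derivative D s) (at s within T)" and D: "continuous_on T D"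
  shows "C1_on (\<lambda>x. F (z x)) \<Omega>" "\<And>x. x \<in> \<Omega> \<Longrightarrow> grad (\<lambda>x. F (z x)) x = D (z x) *\<^sub>R grad z x"
proof -
  have g: "GDERIV (\<lambda>x. F (z x)) x :> D (z x) *\<^sub>R grad z x" if "x \<in> \<Omega>" for x
    using GDERIV_comp_within[OF C1_on_imp_GDERIV[OF assms(2,1) that] zT F[OF zT]] .
  show "C1_on (\<lambda>x. F (z x)) \<Omega>"
  proof (rule C1_onI_GDERIV[OF g])
    show "continuous_on \<Omega> (\<lambda>x. D (z x) *\<^sub>R grad z x)"
      using zT by (intro continuous_on_scaleR C1_on_imp_continuous_on assms(3)
          continuous_on_compose2[OF D C1_on_imp_continuous_on[OF assms(2)]]) auto
  qed
  show "grad (\<lambda>x. F (z x)) x = D (z x) *\<^sub>R grad z x" if "x \<in> \<Omega>" for x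
    using grad_eq_GDERIV[OF g[OF that]] .
qed

text \<open>The derivative is bounded on the compact interval, and the mean value inequality
  applies. The constant feeds \<open>mixed_bc_lipschitz_comp\<close>.\<close>

lemma lipschitz_of_continuous_derivative:
  fixes F :: "real \<Rightarrow> real"
  assumes F: "\<And>s. s \<in> {p..q} \<Longrightarrow> (F has_real_derivative D s) (at s within {p..q})"
    and D: "continuous_on {p..q} D"
  shows "\<exists>L. \<forall>s\<in>{p..q}. \<forall>t\<in>{p..q}. \<bar>F s - F t\<bar> \<le> L * \<bar>s - t\<bar>"
proof -
  have "bounded (D ` {p..q})"
    by (intro compact_imp_bounded compact_continuous_image D compact_Icc)
  then obtain L where L: "\<forall>s\<in>{p..q}. norm (D s) \<le> L"
    unfolding bounded_iff by auto
  have "\<bar>F s - F t\<bar> \<le> L * \<bar>s - t\<bar>" if "s \<in> {p..q}" "t \<in> {p..q}" for s t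
    using field_differentiable_bound[OF _ F, of L s t] L that by simp
  then show ?thesis by blast
qed

section \<open>Construction of the functional solution\<close>

theorem theorem2p6:
  fixes \<Omega> \<Gamma>\<^sub>1 \<Gamma>\<^sub>2 \<Gamma>\<^sub>3 :: "'a::euclidean_space set"
    and n :: "'a \<Rightarrow> 'a"
    and a b :: "real \<Rightarrow> real \<Rightarrow> real"
    and U :: "real \<Rightarrow> real"
    and u\<^sub>1 u\<^sub>2 w\<^sub>1 w\<^sub>2 \<gamma> :: real
  assumes "open \<Omega>" and "bounded \<Omega>"
    and "\<Gamma>\<^sub>1 \<union> \<Gamma>\<^sub>2 \<union> \<Gamma>\<^sub>3 = frontier \<Omega>"
    and "\<Gamma>\<^sub>1 \<inter> \<Gamma>\<^sub>2 = {}" and "\<Gamma>\<^sub>1 \<inter> \<Gamma>\<^sub>3 = {}" and "\<Gamma>\<^sub>2 \<inter> \<Gamma>\<^sub>3 = {}"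
    and "\<And>x. x \<in> \<Gamma>\<^sub>3 \<Longrightarrow> outward_unit_normal \<Omega> x (n x)"
    and "\<exists>z. mixed_laplace_solution \<Omega> \<Gamma>\<^sub>1 \<Gamma>\<^sub>2 \<Gamma>\<^sub>3 n z"
    and "u\<^sub>1 \<le> u\<^sub>2" and "w\<^sub>1 < w\<^sub>2"
    and "continuous_on ({u\<^sub>1..u\<^sub>2} \<times> {w\<^sub>1..w\<^sub>2}) (\<lambda>(u, w). a u w)"
    and "continuous_on ({u\<^sub>1..u\<^sub>2} \<times> {w\<^sub>1..w\<^sub>2}) (\<lambda>(u, w). b u w)"
    and "\<And>u w. (u, w) \<in> {u\<^sub>1..u\<^sub>2} \<times> {w\<^sub>1..w\<^sub>2} \<Longrightarrow> a u w > 0"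
    and "\<And>u w. (u, w) \<in> {u\<^sub>1..u\<^sub>2} \<times> {w\<^sub>1..w\<^sub>2} \<Longrightarrow> b u w > 0"
    and "C1_on U {w\<^sub>1..w\<^sub>2}"
    and "\<And>w. w \<in> {w\<^sub>1..w\<^sub>2} \<Longrightarrow>
           (U has_real_derivative \<gamma> * (b (U w) w / a (U w) w)) (at w within {w\<^sub>1..w\<^sub>2})"
    and "U w\<^sub>1 = u\<^sub>1" and "U w\<^sub>2 = u\<^sub>2"
  shows "\<exists>u w. classical_solution a b \<Omega> \<Gamma>\<^sub>1 \<Gamma>\<^sub>2 \<Gamma>\<^sub>3 n u\<^sub>1 u\<^sub>2 w\<^sub>1 w\<^sub>2 u w \<and>
               functional_by U w\<^sub>1 w\<^sub>2 \<Omega> u w"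
proof -
  obtain z0 where z0: "mixed_laplace_solution \<Omega> \<Gamma>\<^sub>1 \<Gamma>\<^sub>2 \<Gamma>\<^sub>3 n z0" using assms(8) by blast
  \<comment> \<open>Truncation puts all values into \<open>{0..1}\<close>, where
    \<open>\<Psi>\<close> is controlled.\<close>
  define z where "z x = clamp01 (z0 x)" for x
  have "mixed_laplace_solution \<Omega> \<Gamma>\<^sub>1 \<Gamma>\<^sub>2 \<Gamma>\<^sub>3 n z"
    unfolding z_def[abs_def]
    by (rule mixed_laplace_solution_clamp01[OF assms(1-3) assms(7) z0])
  then have zc: "continuous_on (closure \<Omega>) z" and z1: "C1_on z \<Omega>" and z2: "C1_on (grad z) \<Omega>"
    and zl: "\<And>x. x \<in> \<Omega> \<Longrightarrow> laplacian z x = 0" and zbc: "mixed_bc \<Gamma>\<^sub>1 \<Gamma>\<^sub>2 \<Gamma>\<^sub>3 n 0 1 z"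
    unfolding mixed_laplace_solution_def by auto
  have z01: "z y \<in> {0..1}" for y unfolding z_def by (rule clamp01_mem)
  let ?I = "{w\<^sub>1..w\<^sub>2}"
  have U_range: "U t \<in> {u\<^sub>1..u\<^sub>2}" if "t \<in> ?I" for t
  proof (rule ode_solution_range[where g = "\<lambda>v t. b v t / a v t" and U = U
        and \<gamma> = \<gamma> and p = w\<^sub>1 and q = w\<^sub>2])
    show "0 < b v t / a v t" if "v \<in> {u\<^sub>1..u\<^sub>2}" "t \<in> ?I" for v t
      using assms(13)[of v t] assms(14)[of v t] that by simp
  qed (fact assms(16) assms(9,17,18) that)+
  have U_cont: "continuous_on ?I U" using assms(15) by (rule C1_on_imp_continuous_on)
  \<comment> \<open>The solution curve stays in the rectangle, so both coefficients are continuous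
    and positive along it.\<close>
  have R: "continuous_on ?I (\<lambda>t. (U t, t))" "(\<lambda>t. (U t, t)) ` ?I \<subseteq> {u\<^sub>1..u\<^sub>2} \<times> ?I"
    using continuous_on_Pair[OF U_cont continuous_on_id] U_range by blast+
  define \<alpha> where "\<alpha> t = a (U t) t" for t
  define \<beta> where "\<beta> t = b (U t) t" for t
  have \<alpha>c: "continuous_on ?I \<alpha>" and \<beta>c: "continuous_on ?I \<beta>"
    using continuous_on_compose2[OF assms(11) R] continuous_on_compose2[OF assms(12) R]
    by (simp_all add: \<alpha>_def[abs_def] \<beta>_def[abs_def])
  have pos: "0 < \<alpha> t" "0 < \<beta> t" if "t \<in> ?I" for t
    using assms(13,14)[of "U t" t] U_range[OF that] that by (auto simp: \<alpha>_def \<beta>_def)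
  obtain K \<Psi> where K: "K > 0" "\<Psi> 0 = w\<^sub>1" "\<Psi> 1 = w\<^sub>2"
    and \<Psi>: "\<forall>s\<in>{0..1}. \<Psi> s \<in> ?I \<and> (\<Psi> has_real_derivative K / \<beta> (\<Psi> s)) (at s within {0..1})"
    using inverse_normalized_antiderivative[OF assms(10) \<beta>c pos(2)] .
  have \<Psi>I: "\<Psi> s \<in> ?I" and \<Psi>': "(\<Psi> has_real_derivative K / \<beta> (\<Psi> s)) (at s within {0..1})"
    if "s \<in> {0..1}" for s using \<Psi> that by auto
  have \<Psi>c: "continuous_on {0..1} \<Psi>" by (rule DERIV_continuous_on[OF \<Psi>'])
  have \<Psi>img: "\<Psi> ` {0..1} \<subseteq> ?I" using \<Psi>I by blast
  have \<Psi>'c: "continuous_on {0..1} (\<lambda>s. K / \<beta> (\<Psi> s))"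
    using pos(2)[OF \<Psi>I]
    by (intro continuous_intros continuous_on_compose2[OF \<beta>c \<Psi>c \<Psi>img]) force
  \<comment> \<open>The factor \<open>\<beta>\<close> in the equation for \<open>U\<close> cancels
    against the one in the derivative of \<open>\<Psi>\<close>.\<close>
  have U\<Psi>': "((\<lambda>s. U (\<Psi> s)) has_real_derivative \<gamma> * K / \<alpha> (\<Psi> s)) (at s within {0..1})"
    if s: "s \<in> {0..1}" for s
  proof -
    have "(U has_real_derivative \<gamma> * (\<beta> (\<Psi> s) / \<alpha> (\<Psi> s))) (at (\<Psi> s) within \<Psi> ` {0..1})"
      using DERIV_subset[OF assms(16)[OF \<Psi>I[OF s]] \<Psi>img] by (simp add: \<alpha>_def \<beta>_def)
    from DERIV_image_chain[OF this \<Psi>'[OF s]] show ?thesis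
      using pos(2)[OF \<Psi>I[OF s]] by (simp add: o_def)
  qed
  have U\<Psi>'c: "continuous_on {0..1} (\<lambda>s. \<gamma> * K / \<alpha> (\<Psi> s))"
    using pos(1)[OF \<Psi>I]
    by (intro continuous_intros continuous_on_compose2[OF \<alpha>c \<Psi>c \<Psi>img]) force
  define w where "w x = \<Psi> (z x)" for x
  define u where "u x = U (\<Psi> (z x))" for x
  have w1: "C1_on w \<Omega>" and gw: "\<And>x. x \<in> \<Omega> \<Longrightarrow> grad w x = (K / \<beta> (w x)) *\<^sub>R grad z x"
    using C1_on_comp_within[OF assms(1) z1 z2 z01 \<Psi>' \<Psi>'c] by (auto simp: w_def[abs_def])
  have u1: "C1_on u \<Omega>" and gu: "\<And>x. x \<in> \<Omega> \<Longrightarrow> grad u x = (\<gamma> * K / \<alpha> (w x)) *\<^sub>R grad z x"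
    using C1_on_comp_within[OF assms(1) z1 z2 z01 U\<Psi>' U\<Psi>'c]
    by (auto simp: u_def[abs_def] w_def[abs_def])
  have wI: "w x \<in> ?I" for x unfolding w_def by (rule \<Psi>I[OF z01])
  \<comment> \<open>The coefficients cancel, leaving constant multiples of \<open>grad z\<close>;
    thus the fluxes are of class C1 even though \<open>a\<close> and \<open>b\<close> are merely
    continuous.\<close>
  have flux_w: "K *\<^sub>R grad z x = b (u x) (w x) *\<^sub>R grad w x" if "x \<in> \<Omega>" for x
    using gw[OF that] pos(2)[OF wI, of x] by (simp add: \<beta>_def u_def w_def)
  have flux_u: "(\<gamma> * K) *\<^sub>R grad z x = a (u x) (w x) *\<^sub>R grad u x" if "x \<in> \<Omega>" for x
    using gu[OF that] pos(1)[OF wI, of x] by (simp add: \<alpha>_def u_def w_def)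
  have flux: "C1_on F \<Omega> \<and> (\<forall>x\<in>\<Omega>. divergence F x = 0)"
    if F: "\<And>x. x \<in> \<Omega> \<Longrightarrow> c *\<^sub>R grad z x = F x" for F c
  proof (intro conjI ballI)
    show "C1_on F \<Omega>" using C1_on_cong[OF C1_on_scaleR[OF z2] F] .
    show "divergence F x = 0" if "x \<in> \<Omega>" for x
      using divergence_cong_open[OF assms(1) that F] divergence_scaleR[OF z2 assms(1) that, of c]
        zl[OF that] by (simp add: laplacian_def)
  qed
  obtain L where L: "\<forall>s\<in>{0..1}. \<forall>t\<in>{0..1}. \<bar>\<Psi> s - \<Psi> t\<bar> \<le> L * \<bar>s - t\<bar>"
    using lipschitz_of_continuous_derivative[OF \<Psi>' \<Psi>'c] by blast
  from mixed_bc_lipschitz_comp[OF zbc z01 L[rule_format]]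
  have bcw: "mixed_bc \<Gamma>\<^sub>1 \<Gamma>\<^sub>2 \<Gamma>\<^sub>3 n w\<^sub>1 w\<^sub>2 w" using K by (simp add: w_def[abs_def])
  obtain L' where L': "\<forall>s\<in>{0..1}. \<forall>t\<in>{0..1}. \<bar>U (\<Psi> s) - U (\<Psi> t)\<bar> \<le> L' * \<bar>s - t\<bar>"
    using lipschitz_of_continuous_derivative[OF U\<Psi>' U\<Psi>'c] by blast
  from mixed_bc_lipschitz_comp[where F = "\<lambda>s. U (\<Psi> s)", OF zbc z01 L'[rule_format]]
  have bcu: "mixed_bc \<Gamma>\<^sub>1 \<Gamma>\<^sub>2 \<Gamma>\<^sub>3 n u\<^sub>1 u\<^sub>2 u" using K assms(17,18) by (simp add: u_def[abs_def])
  have wc: "continuous_on (closure \<Omega>) w"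
    unfolding w_def[abs_def] using z01 by (intro continuous_on_compose2[OF \<Psi>c zc]) auto
  have uc: "continuous_on (closure \<Omega>) u"
  proof -
    have "w ` closure \<Omega> \<subseteq> ?I" using wI by blast
    from continuous_on_compose2[OF U_cont wc this] show ?thesis
      by (simp add: u_def[abs_def] w_def)
  qed
  have "classical_solution a b \<Omega> \<Gamma>\<^sub>1 \<Gamma>\<^sub>2 \<Gamma>\<^sub>3 n u\<^sub>1 u\<^sub>2 w\<^sub>1 w\<^sub>2 u w"
    unfolding classical_solution_def
    using uc wc u1 w1 flux[OF flux_u] flux[OF flux_w] bcu bcw by simp
  moreover have "functional_by U w\<^sub>1 w\<^sub>2 \<Omega> u w"
    unfolding functional_by_def using assms(15) wI by (simp add: u_def w_def)
  ultimately show ?thesis by blast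
qed

end
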